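(* The proportion of leaves in the top cell of an $n$-point domino is asymptotically concentrated at its mean. That is, for $n\ge1$ let $X_n$ be the number of leaves in the top cell of a uniformly random $n$-point domino, divided by $n$. Then for every $\varepsilon>0$, for all sufficiently large $n$, $$\mathbb P\big[\,|X_n-\mathbb E[X_n]|\le\varepsilon\,\big]>1-\varepsilon .$$
   Context: A permutation avoids a pattern $\pi$ if it has no subsequence order isomorphic to $\pi$. An $n$-point domino is a pair $(\sigma,r)$ where $\sigma$ is a permutation of length $n$ avoiding $1324$ and $r\in\{1,\dots,n+1\}$, such that the subsequence of entries (points) of $\sigma$ with value at least $r$ (the top cell) avoids $213$, and the subsequence of entries with value less than $r$ (the bottom cell) avoids $132$. Pairs with the same $\sigma$ but different $r$ are distinct dominoes. A point in the top cell of a domino is a leaf if it is a right-to-left maximum of the permutation, i.e. no larger entry lies to its right. *)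

theory Defs
  imports
    "HOL-Probability.Probability"
    "HOL-Combinatorics.Multiset_Permutations"
    "HOL-Library.Sublist"
begin

definition order_isomorphic :: "nat list \<Rightarrow> nat list \<Rightarrow> bool" where
  "order_isomorphic xs ys \<longleftrightarrow>
     length xs = length ys \<and>
     (\<forall>i<length xs. \<forall>j<length xs. xs ! i < xs ! j \<longleftrightarrow> ys ! i < ys ! j)"

definition avoids :: "nat list \<Rightarrow> nat list \<Rightarrow> bool" where
  "avoids xs p \<longleftrightarrow> \<not> (\<exists>ys. subseq ys xs \<and> order_isomorphic ys p)"

text \<open>A permutation of length \<open>n\<close> is given in one-line notation, as a list of length \<open>n\<close>
  with set of entries \<open>{1..n}\<close>. Of a domino \<open>(\<sigma>, r)\<close>, the top cell consists of the entries
  with value at least \<open>r\<close>, the bottom cell of those with value less than \<open>r\<close>.\<close>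

definition top_cell :: "nat list \<times> nat \<Rightarrow> nat list" where
  "top_cell d = filter (\<lambda>v. v \<ge> snd d) (fst d)"

definition bottom_cell :: "nat list \<times> nat \<Rightarrow> nat list" where
  "bottom_cell d = filter (\<lambda>v. v < snd d) (fst d)"

definition dominoes :: "nat \<Rightarrow> (nat list \<times> nat) set" where
  "dominoes n =
     {d. fst d \<in> permutations_of_set {1..n} \<and> snd d \<in> {1..n + 1} \<and>
         avoids (fst d) [1, 3, 2, 4] \<and>
         avoids (top_cell d) [2, 1, 3] \<and>
         avoids (bottom_cell d) [1, 3, 2]}"

text \<open>Points are identified with their positions in \<open>\<sigma>\<close>, numbered from 0. A leaf is a
  right-to-left maximum of the whole permutation \<open>\<sigma>\<close>.\<close>

definition top_leaves :: "nat list \<times> nat \<Rightarrow> nat set" where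
  "top_leaves d =
     {i. i < length (fst d) \<and> fst d ! i \<ge> snd d \<and>
         \<not> (\<exists>j. i < j \<and> j < length (fst d) \<and> fst d ! j > fst d ! i)}"

definition leaf_proportion :: "nat \<Rightarrow> nat list \<times> nat \<Rightarrow> real" where
  "leaf_proportion n d = real (card (top_leaves d)) / real n"

text \<open>\<^const>\<open>pmf_of_set\<close> is only meaningful for finite nonempty sets.\<close>

definition random_domino :: "nat \<Rightarrow> (nat list \<times> nat) pmf" where
  "random_domino n = pmf_of_set (dominoes n)"

lemma finite_dominoes: "finite (dominoes n)"
  by (rule finite_subset[of _ "permutations_of_set {1..n} \<times> {1..n + 1}"])
     (auto simp: dominoes_def)

lemma dominoes_nonempty: "dominoes n \<noteq> {}"
proof -
  define xs where "xs = [1..<Suc n]"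
  have no_descent: "avoids xs p"
    if "i < j" "j < length p" "p ! j < p ! i" for i j :: nat and p
    unfolding avoids_def
  proof safe
    fix ys assume ys: "subseq ys xs" "order_isomorphic ys p"
    have "sorted ys"
      using ys(1) unfolding xs_def by (metis sorted_nths sorted_upt subseq_conv_nths)
    moreover have "ys ! j < ys ! i" "j < length ys"
      using ys(2) that unfolding order_isomorphic_def by auto
    ultimately show False
      using that(1) by (metis less_imp_le_nat not_less sorted_nth_mono)
  qed
  have "bottom_cell (xs, 1) = []" "top_cell (xs, 1) = xs"
    by (auto simp: bottom_cell_def top_cell_def xs_def filter_empty_conv filter_id_conv)
  moreover have "avoids [] [1, 3, 2]"
    by (auto simp: avoids_def order_isomorphic_def)
  moreover have "avoids xs [1, 3, 2, 4]" by (rule no_descent[of 1 2]) auto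
  moreover have "avoids xs [2, 1, 3]" by (rule no_descent[of 0 1]) auto
  moreover have "xs \<in> permutations_of_set {1..n}"
    by (auto simp: xs_def permutations_of_set_def)
  ultimately have "(xs, 1) \<in> dominoes n"
    by (auto simp: dominoes_def)
  thus ?thesis by blast
qed

end

theory Submission
  imports Defs "HOL-Computational_Algebra.Formal_Power_Series"
begin

text \<open>
  Write \<open>D\<^sub>n(x)\<close> for the sum of \<open>x\<close> to the number of top leaves over all dominoes with \<open>n\<close> points.
  For \<open>x > 1\<close>, Markov's inequality bounds the proportion of dominoes with at least \<open>t n\<close> top leaves
  by \<open>D\<^sub>n(x) / (x\<^sup>t\<^sup>n D\<^sub>n(1))\<close>; for \<open>x < 1\<close> the same quantity bounds the proportion with at most \<open>t n\<close> of
  them. Two facts about \<open>D\<^sub>n\<close> therefore suffice: for \<open>x\<close> near 1 its exponential growth rate is at most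
  \<open>27/4 (1 + 5/18 (x - 1) + o(x - 1))\<close>, and at \<open>x = 1\<close> it is at least \<open>27/4\<close>. They make both tails at
  \<open>t = 5/18 \<plusminus> \<epsilon>\<close> exponentially small, so the proportion of leaves is concentrated at \<open>5/18\<close>
  (\<open>leaf_proportion_concentrated\<close>); being bounded, it also has a mean close to \<open>5/18\<close>.

  To find \<open>D\<^sub>n(x)\<close>, build a domino from right to left by prepending points. A new leftmost point
  can be inserted only at certain heights, and listing these live sites by their horizontal extent
  gives a word over two letters, \<open>True\<close> for the top cell and \<open>False\<close> for the bottom cell. The new
  point changes this word in a way that depends on the word alone (\<open>sum_children\<close>), and it is a top
  leaf exactly if it is a new maximum. Hence \<open>D\<^sub>n(x)\<close> is the total weight of the \<open>n\<close>-step walks on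
  binary words that start from the empty word (\<open>walk_gf_eq_sum_dominoes\<close>).

  In such a walk every letter \<open>False\<close> of the final word was written at some moment, and from then on
  the walk to the left of it proceeds as if started afresh. This factorization
  (\<open>walk_weight_append_block\<close>) yields a quadratic functional equation with one catalytic variable,
  which marks the letters \<open>True\<close>. The kernel method turns it into a system for two power series
  \<open>V\<close> and \<open>W\<close> with nonnegative coefficients,
  \<open>V = z (1 + V) + x z V (1 + V) + z V / (1 - W)\<^sup>2\<close> and \<open>W = z / (1 - W) + x z W (1 + V)\<^sup>2\<close>, where
  \<open>z D = W (1 - x V\<^sup>2)\<close> for the generating function \<open>D\<close> of the \<open>D\<^sub>n(x)\<close>. Any numerical
  supersolution of the system at some \<open>z\<close> bounds the growth rate by \<open>1/z\<close>. At \<open>x = 1\<close> the critical point is \<open>z = 4/27\<close>, \<open>V = 1/2\<close>, \<open>W = 1/3\<close>, and a first order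
  perturbation of it gives the upper bound near \<open>x = 1\<close> (\<open>near_critical_ratio\<close>). For the lower bound,
  at \<open>x = 1\<close> the series \<open>g = 1 + V = 1/(1 - W)\<close> counts ternary trees, \<open>g = 1 + z g\<^sup>3\<close>, and
  \<open>(z D)' = g\<^sup>4\<close> (\<open>walk_gf_lower_bound\<close>).
\<close>

unbundle no vec_syntax and fps_syntax

section \<open>Substitution for the inner variable of a bivariate power series\<close>

text \<open>The outer variable of \<open>F\<close> is identified with the variable of its coefficients.\<close>

definition fps_diag :: "real fps fps \<Rightarrow> real fps" where
  "fps_diag F = Abs_fps (\<lambda>n. \<Sum>i\<le>n. (F $ i) $ (n - i))"

text \<open>A coefficient of the diagonal only involves finitely many terms, and any sufficiently long
  partial sum shows it. This reduces multiplicativity to a finite product.\<close>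

lemma fps_diag_nth_trunc:
  assumes "n \<le> N"
  shows "fps_diag F $ n = (\<Sum>i\<le>N. fps_X ^ i * F $ i) $ n"
proof -
  have "(\<Sum>i\<le>N. fps_X ^ i * F $ i) $ n = (\<Sum>i\<le>N. if n < i then 0 else (F $ i) $ (n - i))"
    by (simp add: fps_sum_nth fps_X_power_mult_nth)
  also have "\<dots> = (\<Sum>i\<le>n. (F $ i) $ (n - i))"
    using assms by (intro sum.mono_neutral_cong_right) auto
  finally show ?thesis by (simp add: fps_diag_def)
qed

lemma fps_diag_mult: "fps_diag (F * G) = fps_diag F * fps_diag G"
proof (rule fps_ext)
  fix n
  let ?S = "\<lambda>H. (\<Sum>i\<le>n. fps_X ^ i * H $ i)"
  have "(fps_diag F * fps_diag G) $ n = (\<Sum>k=0..n. ?S F $ k * ?S G $ (n - k))"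
    unfolding fps_mult_nth by (intro sum.cong refl) (simp add: fps_diag_nth_trunc[of _ n])
  also have "\<dots> = (?S F * ?S G) $ n"
    by (simp add: fps_mult_nth)
  also have "?S F * ?S G = (\<Sum>(i,j)\<in>{..n}\<times>{..n}. fps_X ^ (i+j) * (F $ i * G $ j))"
    by (simp add: sum_product sum.cartesian_product power_add mult_ac)
  also have "\<dots> $ n = (\<Sum>(i,j)\<in>{..n}\<times>{..n}. (fps_X ^ (i+j) * (F $ i * G $ j)) $ n)"
    by (simp add: fps_sum_nth case_prod_unfold)
  also have "\<dots> = (\<Sum>(i,j)\<in>{(i,j). i+j \<le> n}. (fps_X ^ (i+j) * (F $ i * G $ j)) $ n)"
    by (intro sum.mono_neutral_right) (auto simp: fps_X_power_mult_nth split: if_splits)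
  also have "\<dots> = (\<Sum>m\<le>n. \<Sum>i\<le>m. (fps_X ^ (i+(m-i)) * (F $ i * G $ (m-i))) $ n)"
    by (rule sum.triangle_reindex_eq)
  also have "\<dots> = (\<Sum>m\<le>n. fps_X ^ m * (F * G) $ m) $ n"
    by (simp add: fps_sum_nth fps_mult_nth sum_distrib_left atLeast0AtMost)
  also have "\<dots> = fps_diag (F * G) $ n"
    by (rule fps_diag_nth_trunc[symmetric]) simp
  finally show "fps_diag (F * G) $ n = (fps_diag F * fps_diag G) $ n" ..
qed

text \<open>In a series in an outer variable \<open>z\<close> whose coefficients are series in an inner variable, the
  inner variable is replaced by the series \<open>v\<close> in \<open>z\<close>. If \<open>v\<close> has no constant term, this is a ring
  homomorphism.\<close>

definition fps_eval :: "real fps \<Rightarrow> real fps fps \<Rightarrow> real fps" where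
  "fps_eval v F = fps_diag (Abs_fps (\<lambda>i. F $ i oo v))"

lemma fps_eval_add: "fps_eval v (F + G) = fps_eval v F + fps_eval v G"
  by (rule fps_ext) (simp add: fps_eval_def fps_diag_def fps_compose_add_distrib sum.distrib)

lemma fps_eval_diff: "fps_eval v (F - G) = fps_eval v F - fps_eval v G"
  by (rule fps_ext) (simp add: fps_eval_def fps_diag_def fps_compose_sub_distrib sum_subtractf)

lemma fps_eval_mult:
  assumes "v $ 0 = 0"
  shows "fps_eval v (F * G) = fps_eval v F * fps_eval v G"
proof -
  have "Abs_fps (\<lambda>i. (F * G) $ i oo v) = Abs_fps (\<lambda>i. F $ i oo v) * Abs_fps (\<lambda>i. G $ i oo v)"
    by (rule fps_ext)
       (simp add: fps_mult_nth fps_compose_sum_distrib fps_compose_mult_distrib[OF assms])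
  thus ?thesis by (simp add: fps_eval_def fps_diag_mult)
qed

lemma fps_eval_const: "fps_eval v (fps_const c) = c oo v"
proof (rule fps_ext)
  fix n
  have "fps_eval v (fps_const c) $ n = (\<Sum>i\<le>n. (if i = 0 then c oo v else 0) $ (n - i))"
    by (auto simp: fps_eval_def fps_diag_def intro!: sum.cong)
  also have "\<dots> = (\<Sum>i\<in>{0}. (if i = 0 then c oo v else 0) $ (n - i))"
    by (rule sum.mono_neutral_right) auto
  finally show "fps_eval v (fps_const c) $ n = (c oo v) $ n" by simp
qed

lemma fps_eval_X: "fps_eval v fps_X = fps_X"
proof (rule fps_ext)
  fix n
  have "fps_eval v fps_X $ n = (\<Sum>i\<le>n. if i = 1 then 1 $ (n - i) else 0)"
    unfolding fps_eval_def fps_diag_def fps_nth_Abs_fps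
    by (intro sum.cong) (auto simp: fps_X_def)
  also have "\<dots> = fps_X $ n" by (auto simp: fps_X_def)
  finally show "fps_eval v fps_X $ n = fps_X $ n" .
qed

lemma fps_eval_1: "fps_eval v 1 = 1"
  using fps_eval_const[of v 1] by simp

text \<open>A series in \<open>z\<close> alone, regarded as a bivariate series constant in the inner variable.\<close>

definition fps_lift :: "real fps \<Rightarrow> real fps fps" where
  "fps_lift Q = Abs_fps (\<lambda>n. fps_const (Q $ n))"

lemma fps_eval_lift: "fps_eval v (fps_lift Q) = Q"
proof (rule fps_ext)
  fix n
  have "fps_eval v (fps_lift Q) $ n = (\<Sum>i\<le>n. if i = n then Q $ i else 0)"
    by (auto simp: fps_eval_def fps_diag_def fps_lift_def intro!: sum.cong)
  thus "fps_eval v (fps_lift Q) $ n = Q $ n" by simp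
qed

definition fps_deriv_inner :: "real fps fps \<Rightarrow> real fps fps" where
  "fps_deriv_inner F = Abs_fps (\<lambda>n. fps_deriv (F $ n))"

lemma fps_deriv_inner_add: "fps_deriv_inner (F + G) = fps_deriv_inner F + fps_deriv_inner G"
  and fps_deriv_inner_diff: "fps_deriv_inner (F - G) = fps_deriv_inner F - fps_deriv_inner G"
  by (rule fps_ext, simp add: fps_deriv_inner_def)+

lemma fps_deriv_inner_mult:
  "fps_deriv_inner (F * G) = fps_deriv_inner F * G + F * fps_deriv_inner G"
  by (rule fps_ext)
     (simp add: fps_deriv_inner_def fps_mult_nth fps_deriv_sum sum.distrib[symmetric] add.commute)

lemma fps_deriv_inner_const: "fps_deriv_inner (fps_const c) = fps_const (fps_deriv c)"
  and fps_deriv_inner_X: "fps_deriv_inner fps_X = 0"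
  and fps_deriv_inner_1: "fps_deriv_inner 1 = 0"
  and fps_deriv_inner_lift: "fps_deriv_inner (fps_lift Q) = 0"
  by (rule fps_ext, simp add: fps_deriv_inner_def fps_X_def fps_lift_def)+

definition fps_agree :: "nat \<Rightarrow> real fps \<Rightarrow> real fps \<Rightarrow> bool" where
  "fps_agree n f g \<longleftrightarrow> (\<forall>i<n. f $ i = g $ i)"

lemma fps_agree_add: "fps_agree n f g \<Longrightarrow> fps_agree n f' g' \<Longrightarrow> fps_agree n (f + f') (g + g')"
  and fps_agree_diff: "fps_agree n f g \<Longrightarrow> fps_agree n f' g' \<Longrightarrow> fps_agree n (f - f') (g - g')"
  and fps_agree_mult: "fps_agree n f g \<Longrightarrow> fps_agree n f' g' \<Longrightarrow> fps_agree n (f * f') (g * g')"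
  and fps_agree_refl: "fps_agree n f f"
  by (auto simp: fps_agree_def fps_mult_nth)

lemma fps_agree_X_mult: "fps_agree n f g \<Longrightarrow> fps_agree (Suc n) (fps_X * f) (fps_X * g)"
  by (auto simp: fps_agree_def)

lemma fps_agree_eval:
  assumes "fps_agree n v v'"
  shows "fps_agree n (fps_eval v F) (fps_eval v' F)"
proof -
  have pow: "fps_agree n (v ^ k) (v' ^ k)" for k
    by (induction k) (auto intro: fps_agree_mult fps_agree_refl assms)
  show ?thesis
    unfolding fps_agree_def fps_eval_def fps_diag_def
    using pow by (auto simp: fps_agree_def fps_compose_nth intro!: sum.cong)
qed

text \<open>Banach's fixed point theorem for the \<open>z\<close>-adic metric: the iterates from 0 stabilize
  coefficient by coefficient.\<close>

lemma fps_fixpoint_exists: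
  assumes "\<And>n f g. fps_agree n f g \<Longrightarrow> fps_agree (Suc n) (\<Phi> f) (\<Phi> g)"
  shows "\<exists>f. f = \<Phi> f"
proof -
  define it where "it k = (\<Phi> ^^ k) 0" for k
  have step: "fps_agree k (it k) (it (Suc k))" for k
  proof (induction k)
    case 0 show ?case by (simp add: fps_agree_def)
  next
    case (Suc k) thus ?case using assms[OF Suc] by (simp add: it_def)
  qed
  have later: "fps_agree k (it k) (it (k + m))" for k m
  proof (induction m)
    case 0 show ?case by (simp add: fps_agree_refl)
  next
    case (Suc m) thus ?case using step[of "k + m"] by (auto simp: fps_agree_def)
  qed
  define f where "f = Abs_fps (\<lambda>n. it (Suc n) $ n)"
  have f: "fps_agree n f (it n)" for n
    unfolding fps_agree_def
  proof safe
    fix i assume "i < n"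
    hence "n = Suc i + (n - Suc i)" by simp
    thus "f $ i = it n $ i"
      using later[of "Suc i" "n - Suc i"] by (auto simp: fps_agree_def f_def)
  qed
  have "f $ n = \<Phi> f $ n" for n
  proof -
    have "fps_agree (Suc n) (\<Phi> f) (\<Phi> (it n))" by (rule assms[OF f])
    hence "\<Phi> f $ n = it (Suc n) $ n" by (simp add: fps_agree_def it_def)
    thus ?thesis by (simp add: f_def)
  qed
  thus ?thesis by (auto intro: fps_ext)
qed

section \<open>The kernel method for one catalytic equation\<close>

text \<open>Let the equation be written as \<open>P(R, Q, v) = 0\<close>, where the unknown \<open>Q\<close> does not involve the
  catalytic variable \<open>v\<close>. Differentiating with respect to \<open>v\<close> gives \<open>P\<^sub>R R' + P\<^sub>v = 0\<close>. If \<open>v\<close> is replaced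
  by a series \<open>V\<close> at which \<open>P\<^sub>R\<close> vanishes, then \<open>P\<^sub>v\<close> vanishes there as well, and \<open>P = P\<^sub>R = P\<^sub>v = 0\<close> are
  three polynomial equations for the three series \<open>V\<close>, \<open>W = z R(V)\<close> and \<open>Q\<close>. The condition \<open>P\<^sub>R = 0\<close> has
  the form \<open>V = z (\<dots>)\<close>, so \<open>V\<close> exists as a fixed point. The form of the conclusion matters:
  the right-hand sides for \<open>V\<close> and \<open>W\<close> have nonnegative coefficients. \<open>J\<close> stands for \<open>1/(1 - W)\<close>.\<close>

lemma kernel_method:
  fixes R :: "real fps fps" and Q :: "real fps" and x :: real
  defines "z \<equiv> fps_X :: real fps fps" and "v \<equiv> fps_const fps_X :: real fps fps"
    and "c \<equiv> fps_const (fps_const x) :: real fps fps"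
  assumes eq: "v * (R - z * R * R) = v + c * z * (1 + v) * v * (R - z * R * R)
     + z * (1 + v) * (R - z * R * R + z * fps_lift Q * R - fps_lift Q)"
  obtains V W J :: "real fps" where
    "V = fps_X * (1 + V) + fps_const x * fps_X * V * (1 + V) + fps_X * V * J * J"
    "W = fps_X * J + fps_const x * fps_X * W * (1 + V) * (1 + V)"
    "J = 1 + W * J"
    "fps_X * Q = W * (1 - fps_const x * V * V)"
proof -
  define X where "X = (fps_X :: real fps)"
  define C where "C = fps_const x"
  \<comment> \<open>\<open>V = \<Phi> V\<close> says that the coefficient of \<open>R'\<close> in the differentiated equation vanishes at \<open>V\<close>.\<close>
  define \<Phi> where "\<Phi> V = (let r = fps_eval V R in X * (2 * r * V + C * V * (1 + V) * (1 - 2 * X * r)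
      + (1 + V) * (1 - 2 * X * r + X * Q)))" for V
  have "\<exists>V. V = \<Phi> V"
    unfolding \<Phi>_def Let_def X_def
    by (rule fps_fixpoint_exists,
        intro fps_agree_X_mult fps_agree_add fps_agree_mult fps_agree_diff fps_agree_refl fps_agree_eval)
       assumption+
  then obtain V where V: "V = \<Phi> V" by blast
  have V0: "V $ 0 = 0" by (subst V) (simp add: \<Phi>_def X_def Let_def)
  define r where "r = fps_eval V R"
  define W where "W = X * r"
  note ev = fps_eval_add fps_eval_diff fps_eval_mult[OF V0] fps_eval_const fps_eval_X fps_eval_1
            fps_eval_lift
  have Xz: "fps_eval V z = X" "fps_eval V v = V" "fps_eval V c = C"
    using V0 by (auto simp: z_def v_def c_def X_def C_def fps_eval_X fps_eval_const)
  \<comment> \<open>The functional equation at \<open>V\<close>.\<close>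
  have E2: "V * (r - X * r * r) = V + C * X * (1 + V) * V * (r - X * r * r)
      + X * (1 + V) * (r - X * r * r + X * Q * r - Q)"
    using arg_cong[OF eq, of "fps_eval V"] unfolding ev Xz r_def[symmetric] .
  have D: "fps_deriv_inner z = 0" "fps_deriv_inner v = 1" "fps_deriv_inner c = 0"
    by (simp_all add: z_def v_def c_def fps_deriv_inner_X fps_deriv_inner_const)
  define r' where "r' = fps_eval V (fps_deriv_inner R)"
  have z0: "fps_eval V 0 = 0" using fps_eval_diff[of V 0 0] by simp
  \<comment> \<open>The derivative of the functional equation at \<open>V\<close>; by the choice of \<open>V\<close>, expressed by
    \<open>K\<close> below, the terms with \<open>r'\<close> cancel.\<close>
  have E3': "(r - X * r * r) + V * (r' - X * r' * r - X * r * r') = 1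
      + C * X * ((1 + V) + V) * (r - X * r * r)
      + C * X * (1 + V) * V * (r' - X * r' * r - X * r * r')
      + X * (r - X * r * r + X * Q * r - Q) + X * (1 + V) * (r' - X * r' * r - X * r * r' + X * Q * r')"
    using arg_cong[OF arg_cong[OF eq, of fps_deriv_inner], of "fps_eval V"]
    unfolding fps_deriv_inner_add fps_deriv_inner_diff fps_deriv_inner_mult
      fps_deriv_inner_1 fps_deriv_inner_lift D ev Xz r_def[symmetric] r'_def[symmetric] z0
    by (simp add: algebra_simps)
  have K: "V * (1 - 2 * W) = C * X * V * (1 + V) * (1 - 2 * W) + X * (1 + V) * (1 - 2 * W + X * Q)"
    using V unfolding \<Phi>_def Let_def r_def[symmetric] W_def by (simp add: algebra_simps)
  have E3: "r - X * r * r = 1 + C * X * (1 + 2 * V) * (r - X * r * r)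
      + X * (r - X * r * r + X * Q * r - Q)"
    using E3' K unfolding W_def by algebra
  define J where "J = inverse (1 - W)"
  have W0: "(1 - W) $ 0 \<noteq> 0" by (simp add: W_def X_def)
  have J: "J * (1 - W) = 1" unfolding J_def using W0 by (rule inverse_mult_eq_1)
  have W1: "1 - W \<noteq> 0" using W0 by auto
  have X1: "X \<noteq> 0" by (simp add: X_def)
  have F2: "V * W = X * V * J + C * X * (1 + V) * V * W + X * (1 + V) * (W - X * Q)"
  proof -
    have "(1 - W) * (V * W - (X * V * J + C * X * (1 + V) * V * W + X * (1 + V) * (W - X * Q)))
      = X * (V * (r - X * r * r) - (V + C * X * (1 + V) * V * (r - X * r * r)
      + X * (1 + V) * (r - X * r * r + X * Q * r - Q)))"
      using J unfolding W_def by algebra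
    also have "\<dots> = 0" using E2 by simp
    finally show ?thesis using W1 by simp
  qed
  have F3: "W = X * J + C * X * (1 + 2 * V) * W + X * (W - X * Q)"
  proof -
    have "(1 - W) * (W - (X * J + C * X * (1 + 2 * V) * W + X * (W - X * Q)))
      = X * (r - X * r * r - (1 + C * X * (1 + 2 * V) * (r - X * r * r)
      + X * (r - X * r * r + X * Q * r - Q)))"
      using J unfolding W_def by algebra
    also have "\<dots> = 0" using E3 by simp
    finally show ?thesis using W1 by simp
  qed
  have Q: "X * Q = W * (1 - C * V * V)"
  proof -
    have "X * (W - X * Q - C * W * V * V) = 0" using F2 F3 by algebra
    hence "W - X * Q - C * W * V * V = 0" using X1 by simp
    thus ?thesis by algebra
  qed
  have "W = X * J + C * X * W * (1 + V) * (1 + V)"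
    using F3 Q by algebra
  moreover have "V = X * (1 + V) + C * X * V * (1 + V) + X * V * J * J"
  proof -
    define k where "k = V - C * X * V * (1 + V) - X * (1 + V)"
    have "k * (1 - W) = X * V * J" using K F2 unfolding k_def by algebra
    hence "k = X * V * J * J" using J by algebra
    thus ?thesis unfolding k_def by algebra
  qed
  moreover have "J = 1 + W * J" using J by algebra
  ultimately show thesis using Q that unfolding X_def C_def by blast
qed

section \<open>Weighted walks on binary words\<close>

text \<open>The results of inserting a top point that is not a new maximum: it uses one of the live sites of
  the top cell and destroys everything to the left of that site.\<close>

fun top_suffixes :: "bool list \<Rightarrow> bool list list" where
  "top_suffixes [] = []"
| "top_suffixes (True # w) = (True # w) # top_suffixes w"
| "top_suffixes (False # w) = top_suffixes w"

text \<open>The effect on the existing sites of inserting a bottom point: some number of the leftmost sites of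
  the bottom cell are destroyed, and the sites of the top cell survive.\<close>

fun bottom_deletions :: "bool list \<Rightarrow> bool list list" where
  "bottom_deletions [] = [[]]"
| "bottom_deletions (True # w) = map ((#) True) (bottom_deletions w)"
| "bottom_deletions (False # w) = (False # w) # bottom_deletions w"

text \<open>The weight of an insertion that turns the word \<open>w\<close> into \<open>w'\<close>: it is \<open>x\<close> for a new maximum of the top
  cell and 1 for all other insertions.\<close>

fun step_weight :: "real \<Rightarrow> bool list \<Rightarrow> bool list \<Rightarrow> real" where
  "step_weight x w [] = 0"
| "step_weight x w (True # t) = x * of_bool (t = w) + of_bool (suffix (True # t) w)"
| "step_weight x w (False # t) = of_bool (t \<in> set (bottom_deletions w))"

fun walk_weight :: "real \<Rightarrow> nat \<Rightarrow> bool list \<Rightarrow> real" where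
  "walk_weight x 0 w = of_bool (w = [])"
| "walk_weight x (Suc n) w' = (\<Sum>w | length w \<le> n. walk_weight x n w * step_weight x w w')"

lemma finite_words [simp, intro]: "finite {w :: bool list. length w \<le> n}"
  using finite_lists_length_le[of "UNIV :: bool set" n] by simp

lemma length_bottom_deletions: "t \<in> set (bottom_deletions w) \<Longrightarrow> length t \<le> length w"
  by (induction w arbitrary: t rule: bottom_deletions.induct) fastforce+

lemma step_weight_length: "step_weight x w w' \<noteq> 0 \<Longrightarrow> length w' \<le> Suc (length w)"
  by (induction x w w' rule: step_weight.induct)
     (auto split: if_splits dest: length_bottom_deletions suffix_length_le simp: of_bool_def)

lemma walk_weight_eq_0: "n < length w \<Longrightarrow> walk_weight x n w = 0"
proof (cases n)
  case (Suc k)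
  assume "n < length w"
  hence "step_weight x w' w = 0" if "length w' \<le> k" for w'
    using step_weight_length[of x w' w] that Suc by force
  thus ?thesis using Suc by simp
qed auto

lemma walk_weight_nonzeroD: "walk_weight x n w \<noteq> 0 \<Longrightarrow> length w \<le> n"
  using walk_weight_eq_0 not_le by blast

lemma walk_weight_Nil [simp]: "walk_weight x n [] = of_bool (n = 0)"
  by (cases n) auto

lemma walk_weight_Suc: "n \<le> N \<Longrightarrow> walk_weight x (Suc n) w' = (\<Sum>w | length w \<le> N. walk_weight x n w * step_weight x w w')"
  by (auto dest!: walk_weight_nonzeroD intro!: sum.mono_neutral_left)

text \<open>Every word is either a power of \<open>True\<close> or ends in a unique block, preceded by an arbitrary word.\<close>

definition block :: "nat \<Rightarrow> bool list" where
  "block b = False # replicate b True"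

lemma append_block_eq_iff [simp]: "p @ block b = q @ block c \<longleftrightarrow> p = q \<and> b = c"
proof
  assume eq: "p @ block b = q @ block c"
  have tw: "takeWhile id (rev (p @ block b)) = replicate b True" for p b
    by (simp add: block_def takeWhile_append)
  have "replicate b True = replicate c True"
    using tw[of p b] tw[of q c] eq by simp
  hence "b = c" by (metis length_replicate)
  thus "p = q \<and> b = c" using eq by simp
qed auto

lemma replicate_neq_append_block [simp]: "replicate a True \<noteq> p @ block b"
proof
  assume "replicate a True = p @ block b"
  hence "False \<in> set (replicate a True)" by (simp add: block_def)
  thus False by simp
qed

lemma word_cases:
  obtains b where "w = replicate b True" | q b where "w = q @ block b"
proof (induction w arbitrary: thesis)
  case Nil
  show ?case by (rule Nil(1)[of 0]) simp
next
  case (Cons a w)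
  show ?case
  proof (rule Cons.IH)
    fix b assume w: "w = replicate b True"
    show thesis
    proof (cases a)
      case True thus thesis using Cons.prems(1)[of "Suc b"] w by simp
    next
      case False thus thesis using Cons.prems(2)[of "[]" b] w by (simp add: block_def)
    qed
  next
    fix q b assume "w = q @ block b"
    thus thesis using Cons.prems(2)[of "a # q" b] by simp
  qed
qed

lemma bottom_deletions_append_block:
  "q @ block b \<in> set (bottom_deletions w) \<longleftrightarrow> (\<exists>p. w = p @ block b \<and> q \<in> set (bottom_deletions p))"
proof (induction w arbitrary: q rule: bottom_deletions.induct)
  case 1 show ?case by (auto simp: block_def)
next
  case (2 w)
  show ?case
  proof
    assume "q @ block b \<in> set (bottom_deletions (True # w))"
    then obtain t where t: "q @ block b = True # t" "t \<in> set (bottom_deletions w)" by auto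
    then obtain q' where q': "q = True # q'" "t = q' @ block b"
      by (cases q) (auto simp: block_def)
    then obtain p where "w = p @ block b" "q' \<in> set (bottom_deletions p)" using 2 t by auto
    thus "\<exists>p. True # w = p @ block b \<and> q \<in> set (bottom_deletions p)"
      using q' by (intro exI[of _ "True # p"]) auto
  next
    assume "\<exists>p. True # w = p @ block b \<and> q \<in> set (bottom_deletions p)"
    then obtain p where p: "True # w = p @ block b" "q \<in> set (bottom_deletions p)" by blast
    then obtain p' where "p = True # p'" "w = p' @ block b" by (cases p) (auto simp: block_def)
    thus "q @ block b \<in> set (bottom_deletions (True # w))" using p 2 by auto
  qed
next
  case (3 w)
  show ?case
  proof
    assume "q @ block b \<in> set (bottom_deletions (False # w))"
    then consider "q @ block b = False # w" | "q @ block b \<in> set (bottom_deletions w)" by auto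
    thus "\<exists>p. False # w = p @ block b \<and> q \<in> set (bottom_deletions p)"
    proof cases
      case 1
      have "q \<in> set (bottom_deletions q)" using 1 by (cases q) auto
      with 1[symmetric] show ?thesis by blast
    next
      case 2
      then obtain p where "w = p @ block b" "q \<in> set (bottom_deletions p)" using 3 by auto
      thus ?thesis by (intro exI[of _ "False # p"]) auto
    qed
  next
    assume "\<exists>p. False # w = p @ block b \<and> q \<in> set (bottom_deletions p)"
    then obtain p where p: "False # w = p @ block b" "q \<in> set (bottom_deletions p)" by blast
    show "q @ block b \<in> set (bottom_deletions (False # w))"
    proof (cases p)
      case Nil thus ?thesis using p by (simp add: block_def)
    next
      case (Cons a p') thus ?thesis using p 3 by auto
    qed
  qed
qed

text \<open>The two lemmas below express locality: as long as the \<open>False\<close> of a block survives, the letters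
  from that \<open>False\<close> to the right end stay as they are, and the letters to its left evolve as a walk
  of their own.\<close>

lemma step_weight_append_block:
  assumes "q \<noteq> []"
  shows "step_weight x (p @ block b) (q @ block b) = step_weight x p q"
proof (cases q)
  case (Cons a t)
  have "suffix (True # t @ block b) (p @ block b) \<longleftrightarrow> suffix (True # t) p"
    using same_suffix_suffix[of "True # t" "block b" p] by simp
  thus ?thesis using Cons by (cases a) (auto simp: bottom_deletions_append_block)
qed (use assms in auto)

lemma step_weight_append_block_eq_0:
  assumes "q \<noteq> []" "\<And>p. w \<noteq> p @ block b"
  shows "step_weight x w (q @ block b) = 0"
proof (cases q)
  case (Cons a t)
  have "\<not> suffix (True # t @ block b) w"
    using assms(2) by (auto simp: suffix_def) (metis append_Cons append_assoc)
  moreover have "t @ block b \<noteq> w" using assms(2) by blast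
  ultimately show ?thesis using Cons assms(2) by (cases a) (auto simp: bottom_deletions_append_block)
qed (use assms in auto)

text \<open>Split a walk that ends in \<open>q\<close> followed by a block at the time \<open>m\<close> when the \<open>False\<close> of the final
  block is written. At that time the word is just the block, and the remaining \<open>n - m\<close> steps form a
  walk from the empty word to \<open>q\<close>.\<close>

lemma walk_weight_append_block:
  "walk_weight x n (q @ block b) = (\<Sum>m\<le>n. walk_weight x m (block b) * walk_weight x (n - m) q)"
proof (induction n arbitrary: q)
  case 0 thus ?case by (auto simp: block_def)
next
  case (Suc n)
  show ?case
  proof (cases "q = []")
    case True
    have "(\<Sum>m\<le>Suc n. walk_weight x m (block b) * walk_weight x (Suc n - m) q)
        = (\<Sum>m\<le>Suc n. if m = Suc n then walk_weight x m (block b) else 0)"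
      using True by (intro sum.cong) auto
    thus ?thesis using True by simp
  next
    case False
    have "walk_weight x (Suc n) (q @ block b) =
        (\<Sum>w | length w \<le> n + length (block b). walk_weight x n w * step_weight x w (q @ block b))"
      by (rule walk_weight_Suc) simp
    also have "\<dots> = (\<Sum>w\<in>(\<lambda>p. p @ block b) ` {p. length p \<le> n}. walk_weight x n w * step_weight x w (q @ block b))"
    proof (intro sum.mono_neutral_right ballI)
      fix w assume "w \<in> {w. length w \<le> n + length (block b)} - (\<lambda>p. p @ block b) ` {p. length p \<le> n}"
      hence "w \<noteq> p @ block b" for p by auto
      thus "walk_weight x n w * step_weight x w (q @ block b) = 0"
        using step_weight_append_block_eq_0[OF False] by simp
    qed auto
    also have "\<dots> = (\<Sum>p | length p \<le> n. walk_weight x n (p @ block b) * step_weight x p q)"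
      by (subst sum.reindex) (auto simp: inj_on_def step_weight_append_block[OF False])
    also have "\<dots> = (\<Sum>m\<le>n. walk_weight x m (block b) * (\<Sum>p | length p \<le> n. walk_weight x (n - m) p * step_weight x p q))"
      unfolding Suc.IH sum_distrib_left sum_distrib_right
      by (subst sum.swap) (simp add: mult_ac)
    also have "\<dots> = (\<Sum>m\<le>n. walk_weight x m (block b) * walk_weight x (Suc n - m) q)"
      by (intro sum.cong refl) (simp add: walk_weight_Suc[of _ n] Suc_diff_le del: walk_weight.simps)
    also have "\<dots> = (\<Sum>m\<le>Suc n. walk_weight x m (block b) * walk_weight x (Suc n - m) q)"
      using False by simp
    finally show ?thesis .
  qed
qed

text \<open>Summation over all words, organized by their last block.\<close>

lemma sum_words_decompose:
  fixes h :: "bool list \<Rightarrow> real fps"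
  shows "(\<Sum>w | length w \<le> n. fps_const (walk_weight x n w) * h w) =
    (\<Sum>b\<le>n. fps_const (walk_weight x n (replicate b True)) * h (replicate b True)) +
    (\<Sum>b\<le>n. \<Sum>m\<le>n. fps_const (walk_weight x m (block b)) *
       (\<Sum>q | length q \<le> n - m. fps_const (walk_weight x (n - m) q) * h (q @ block b)))"
proof -
  let ?f = "\<lambda>w. fps_const (walk_weight x n w) * h w"
  let ?A = "(\<lambda>b. replicate b True) ` {..n}"
  let ?B = "(\<lambda>(b, q). q @ block b) ` ({..n} \<times> {q. length q \<le> n})"
  have "sum ?f {w. length w \<le> n} = sum ?f (?A \<union> ?B)"
  proof (intro sum.mono_neutral_left ballI subsetI)
    fix w :: "bool list" assume w: "w \<in> {w. length w \<le> n}"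
    show "w \<in> ?A \<union> ?B"
    proof (cases w rule: word_cases)
      case (1 b) thus ?thesis using w by auto
    next
      case (2 q b)
      hence "(b, q) \<in> {..n} \<times> {q. length q \<le> n}" using w by (auto simp: block_def)
      thus ?thesis using 2 by force
    qed
  qed (auto simp: walk_weight_eq_0)
  also have "\<dots> = sum ?f ?A + sum ?f ?B"
    by (intro sum.union_disjoint) auto
  also have "sum ?f ?A = (\<Sum>b\<le>n. ?f (replicate b True))"
    by (subst sum.reindex) (auto simp: inj_on_def replicate_eq_replicate)
  also have "sum ?f ?B = (\<Sum>(b, q)\<in>{..n} \<times> {q. length q \<le> n}. ?f (q @ block b))"
    by (subst sum.reindex) (auto simp: inj_on_def case_prod_unfold)
  also have "\<dots> = (\<Sum>b\<le>n. \<Sum>q | length q \<le> n. ?f (q @ block b))"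
    by (simp add: sum.cartesian_product)
  also have "\<dots> = (\<Sum>b\<le>n. \<Sum>m\<le>n. fps_const (walk_weight x m (block b)) *
       (\<Sum>q | length q \<le> n. fps_const (walk_weight x (n - m) q) * h (q @ block b)))"
  proof (intro sum.cong refl)
    fix b
    have const_sum: "fps_const (\<Sum>m\<le>n. g m) = (\<Sum>m\<le>n. fps_const (g m))" for g :: "nat \<Rightarrow> real"
      by (rule fps_ext) (simp add: fps_sum_nth)
    show "(\<Sum>q | length q \<le> n. ?f (q @ block b)) = (\<Sum>m\<le>n. fps_const (walk_weight x m (block b)) *
       (\<Sum>q | length q \<le> n. fps_const (walk_weight x (n - m) q) * h (q @ block b)))"
      unfolding walk_weight_append_block const_sum sum_distrib_left sum_distrib_right
      by (subst sum.swap) (simp add: mult.assoc flip: fps_const_mult)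
  qed
  also have "\<dots> = (\<Sum>b\<le>n. \<Sum>m\<le>n. fps_const (walk_weight x m (block b)) *
       (\<Sum>q | length q \<le> n - m. fps_const (walk_weight x (n - m) q) * h (q @ block b)))"
    by (intro sum.cong refl arg_cong2[of _ _ _ _ "(*)"] sum.mono_neutral_right) (auto simp: walk_weight_eq_0)
  finally show ?thesis .
qed

definition num_tops :: "bool list \<Rightarrow> nat" where
  "num_tops w = length (filter id w)"

lemma num_tops_simps [simp]: "num_tops (replicate b True) = b" "num_tops (q @ block b) = num_tops q + b"
  by (auto simp: num_tops_def block_def)

text \<open>A word without \<open>False\<close> arises only by deleting all of them.\<close>

lemma replicate_in_bottom_deletions: "replicate b True \<in> set (bottom_deletions w) \<longleftrightarrow> num_tops w = b"
proof (induction w arbitrary: b rule: bottom_deletions.induct)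
  case (2 w) show ?case
    by (cases b) (use 2 in \<open>auto simp: num_tops_def\<close>)
next
  case (3 w)
  have "replicate b True \<noteq> False # w" by (metis in_set_replicate list.set_intros(1))
  thus ?case using 3 by (auto simp: num_tops_def)
qed (auto simp: num_tops_def)

definition walk_gf :: "real \<Rightarrow> real fps" where
  "walk_gf x = Abs_fps (\<lambda>n. \<Sum>w | length w \<le> n. walk_weight x n w)"

text \<open>Here \<open>R\<close> is the generating function of all walks, in which \<open>1 + v\<close> marks the letters \<open>True\<close> of the
  final word; \<open>v = 0\<close> gives the series \<open>walk_gf x\<close>. In the same way let \<open>A\<close> count the walks that end
  in a power of \<open>True\<close> and \<open>T\<close> those that end in a single block. The factorization at the last block
  gives \<open>R = A + T R\<close>, and \<open>T = z R\<close> because a block \<open>False True\<^sup>b\<close> is reached in one step from every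
  word with \<open>b\<close> letters \<open>True\<close>. Finally \<open>A\<close> is determined by the last step: the words
  \<open>True\<^sup>b\<close> with \<open>b \<ge> 1\<close> are reached from \<open>True\<^sup>b\<^sup>-\<^sup>1\<close> by a new maximum and from every word that has them as
  a suffix. Summing the latter contributions over \<open>b\<close> gives geometric sums in \<open>1 + v\<close>, which become
  polynomial after multiplication by \<open>v\<close>.\<close>

lemma walk_functional_equation:
  fixes x :: real
  defines "z \<equiv> fps_X :: real fps fps" and "v \<equiv> fps_const fps_X :: real fps fps"
    and "c \<equiv> fps_const (fps_const x) :: real fps fps"
  obtains R :: "real fps fps" where
    "v * (R - z * R * R) = v + c * z * (1 + v) * v * (R - z * R * R)
     + z * (1 + v) * (R - z * R * R + z * fps_lift (walk_gf x) * R - fps_lift (walk_gf x))"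
proof -
  define u where "u = (1 + fps_X :: real fps)"
  define R where "R = Abs_fps (\<lambda>n. \<Sum>w | length w \<le> n. fps_const (walk_weight x n w) * u ^ num_tops w)"
  define A where "A = Abs_fps (\<lambda>n. \<Sum>b\<le>n. fps_const (walk_weight x n (replicate b True)) * u ^ b)"
  define T where "T = Abs_fps (\<lambda>n. \<Sum>b\<le>n. fps_const (walk_weight x n (block b)) * u ^ b)"
  define L where "L = fps_lift (walk_gf x)"
  have L: "L $ n = (\<Sum>w | length w \<le> n. fps_const (walk_weight x n w))" for n
    by (rule fps_ext) (simp add: L_def fps_lift_def walk_gf_def fps_sum_nth)
  have T_nth: "T $ m = (\<Sum>b\<le>n. fps_const (walk_weight x m (block b)) * u ^ b)" if "m \<le> n" for m n
    using that unfolding T_def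
    by (auto intro!: sum.mono_neutral_left dest!: walk_weight_nonzeroD simp: block_def)
  have RA: "R = A + T * R"
  proof (rule fps_ext)
    fix n
    have "R $ n = A $ n + (\<Sum>b\<le>n. \<Sum>m\<le>n. fps_const (walk_weight x m (block b)) *
       (\<Sum>q | length q \<le> n - m. fps_const (walk_weight x (n - m) q) * u ^ (num_tops q + b)))"
      unfolding R_def A_def fps_nth_Abs_fps by (subst sum_words_decompose) simp
    also have "(\<Sum>b\<le>n. \<Sum>m\<le>n. fps_const (walk_weight x m (block b)) *
       (\<Sum>q | length q \<le> n - m. fps_const (walk_weight x (n - m) q) * u ^ (num_tops q + b)))
       = (\<Sum>m\<le>n. (\<Sum>b\<le>n. fps_const (walk_weight x m (block b)) * u ^ b) * R $ (n - m))"
      unfolding R_def fps_nth_Abs_fps power_add sum_distrib_left sum_distrib_right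
      by (subst sum.swap, simp add: mult_ac, rule sum.cong[OF refl], rule sum.swap)
    also have "\<dots> = (T * R) $ n"
      by (simp add: fps_mult_nth T_nth atLeast0AtMost)
    finally show "R $ n = (A + T * R) $ n" by simp
  qed
  have TR: "T = z * R"
  proof (rule fps_ext)
    fix n show "T $ n = (z * R) $ n"
    proof (cases n)
      case 0 thus ?thesis by (simp add: T_def z_def block_def)
    next
      case (Suc k)
      have const_sum: "fps_const (sum g S) = (\<Sum>m\<in>S. fps_const (g m))" for g :: "bool list \<Rightarrow> real" and S
        by (rule fps_ext) (simp add: fps_sum_nth)
      have "fps_const (walk_weight x (Suc k) (block b)) * u ^ b =
          (\<Sum>w | length w \<le> k. if num_tops w = b then fps_const (walk_weight x k w) * u ^ num_tops w else 0)" for b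
      proof -
        have "walk_weight x (Suc k) (block b) = (\<Sum>w | length w \<le> k. walk_weight x k w * of_bool (num_tops w = b))"
          by (simp add: block_def replicate_in_bottom_deletions del: of_bool_eq_iff sum_mult_of_bool_eq)
        thus ?thesis
          by (auto simp: const_sum sum_distrib_right simp del: walk_weight.simps sum_mult_of_bool_eq intro!: sum.cong)
      qed
      hence "T $ n = (\<Sum>b\<le>Suc k. \<Sum>w | length w \<le> k. if num_tops w = b then fps_const (walk_weight x k w) * u ^ num_tops w else 0)"
        unfolding T_def Suc fps_nth_Abs_fps by (rule sum.cong[OF refl])
      also have "\<dots> = (\<Sum>w | length w \<le> k. \<Sum>b\<le>Suc k. if num_tops w = b then fps_const (walk_weight x k w) * u ^ num_tops w else 0)"
        by (rule sum.swap)
      also have "\<dots> = (\<Sum>w | length w \<le> k. fps_const (walk_weight x k w) * u ^ num_tops w)"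
      proof (intro sum.cong refl)
        fix w assume "w \<in> {w :: bool list. length w \<le> k}"
        hence "num_tops w \<le> Suc k" unfolding num_tops_def using length_filter_le[of id w] by (metis le_SucI le_trans mem_Collect_eq)
        thus "(\<Sum>b\<le>Suc k. if num_tops w = b then fps_const (walk_weight x k w) * u ^ num_tops w else 0)
            = fps_const (walk_weight x k w) * u ^ num_tops w" by (subst sum.delta') auto
      qed
      finally show ?thesis by (simp add: Suc z_def R_def)
    qed
  qed
  have AR: "A = R - z * R * R" using RA TR by (simp add: algebra_simps)
  have "v * A = v + c * z * (1 + v) * v * A + z * (1 + v) * (A + z * L * R - L)"
  proof (rule fps_ext)
    fix n
    have one_v: "1 + v = fps_const u"
      by (rule fps_ext) (simp add: v_def u_def)
    show "(v * A) $ n = (v + c * z * (1 + v) * v * A + z * (1 + v) * (A + z * L * R - L)) $ n"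
    proof (cases n)
      case 0
      have "A $ 0 = 1" by (simp add: A_def)
      thus ?thesis using 0 unfolding z_def v_def c_def by simp
    next
      case (Suc k)
      \<comment> \<open>The total weight of the \<open>k\<close>-step walks whose final word ends in exactly \<open>b\<close> letters \<open>True\<close>.\<close>
      define \<beta> where "\<beta> b = fps_const (walk_weight x k (replicate b True))
        + (\<Sum>m\<le>k. fps_const (walk_weight x m (block b)) * L $ (k - m))" for b
      have suff: "(\<Sum>w | length w \<le> k. fps_const (walk_weight x k w) * h w) = (\<Sum>b\<le>k. \<beta> b * g b)"
        if "\<And>b. h (replicate b True) = g b" "\<And>q b. h (q @ block b) = g b" for h g
        unfolding \<beta>_def L by (subst sum_words_decompose)
          (simp add: that distrib_left distrib_right sum.distrib sum_distrib_left sum_distrib_right mult_ac)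
      have sum_\<beta>: "(\<Sum>b\<le>k. \<beta> b) = L $ k"
        using suff[of "\<lambda>_. 1" "\<lambda>_. 1"] by (simp add: L)
      have sum_\<beta>u: "(\<Sum>b\<le>k. \<beta> b * u ^ b) = A $ k + (T * L) $ k"
      proof -
        have "(\<Sum>b\<le>k. \<beta> b * u ^ b) = A $ k
          + (\<Sum>m\<le>k. (\<Sum>b\<le>k. fps_const (walk_weight x m (block b)) * u ^ b) * L $ (k - m))"
          unfolding \<beta>_def A_def fps_nth_Abs_fps distrib_right sum.distrib sum_distrib_right
          by (subst sum.swap) (simp add: mult_ac)
        thus ?thesis by (simp add: fps_mult_nth T_nth atLeast0AtMost)
      qed
      have const_sum: "fps_const (sum g S) = (\<Sum>m\<in>S. fps_const (g m))" for g :: "bool list \<Rightarrow> real" and S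
        by (rule fps_ext) (simp add: fps_sum_nth)
      have suf: "suffix (True # replicate d True) (replicate b True) \<longleftrightarrow> d < b" for d b
      proof
        assume "suffix (True # replicate d True) (replicate b True)"
        thus "d < b" using suffix_length_le by fastforce
      next
        assume "d < b"
        hence "replicate b True = replicate (b - Suc d) True @ replicate (Suc d) True"
          by (metis Suc_leI le_add_diff_inverse2 replicate_add)
        thus "suffix (True # replicate d True) (replicate b True)"
          by (simp add: suffix_def)
      qed
      have suf': "suffix (True # replicate d True) (q @ block b) \<longleftrightarrow> d < b" for q d b
      proof
        assume "suffix (True # replicate d True) (q @ block b)"
        moreover have "suffix (block b) (q @ block b)" by (simp add: suffix_def)
        ultimately consider "suffix (True # replicate d True) (block b)"
          | "suffix (block b) (True # replicate d True)"
          using suffix_same_cases by blast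
        thus "d < b"
        proof cases
          case 1
          thus ?thesis using suf[of d b] by (auto simp: block_def suffix_Cons)
        next
          case 2
          hence "False \<in> set (True # replicate d True)"
            using set_mono_suffix by (force simp: block_def)
          thus ?thesis by simp
        qed
      next
        assume "d < b"
        thus "suffix (True # replicate d True) (q @ block b)"
          unfolding suf[symmetric] by (auto simp: block_def intro!: suffix_appendI suffix_ConsI)
      qed
      have mass_rep: "fps_const (walk_weight x (Suc k) (replicate (Suc d) True))
          = fps_const x * fps_const (walk_weight x k (replicate d True)) + (\<Sum>b\<le>k. \<beta> b * of_bool (d < b))"
        if "d \<le> k" for d
      proof -
        have "fps_const (walk_weight x (Suc k) (replicate (Suc d) True))
          = (\<Sum>w | length w \<le> k. fps_const (walk_weight x k w) * (fps_const x * of_bool (replicate d True = w)))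
           + (\<Sum>w | length w \<le> k. fps_const (walk_weight x k w) * of_bool (suffix (True # replicate d True) w))"
          unfolding walk_weight.simps replicate_Suc step_weight.simps const_sum sum.distrib[symmetric]
          by (intro sum.cong refl) (auto simp: algebra_simps simp flip: fps_const_mult fps_const_add)
        also have "(\<Sum>w | length w \<le> k. fps_const (walk_weight x k w) * of_bool (suffix (True # replicate d True) w))
          = (\<Sum>b\<le>k. \<beta> b * of_bool (d < b))"
          by (rule suff) (simp_all only: suf suf')
        also have "(\<Sum>w | length w \<le> k. fps_const (walk_weight x k w) * (fps_const x * of_bool (replicate d True = w)))
          = (\<Sum>w\<in>{replicate d True}. fps_const (walk_weight x k w) * (fps_const x * of_bool (replicate d True = w)))"
          using that by (intro sum.mono_neutral_right) auto
        finally show ?thesis by (simp add: mult_ac)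
      qed
      have "A $ n = (\<Sum>d\<le>k. fps_const (walk_weight x (Suc k) (replicate (Suc d) True)) * u ^ Suc d)"
        unfolding A_def fps_nth_Abs_fps Suc by (subst sum.atMost_Suc_shift) simp
      also have "\<dots> = (\<Sum>d\<le>k. (fps_const x * fps_const (walk_weight x k (replicate d True))
          + (\<Sum>b\<le>k. \<beta> b * of_bool (d < b))) * u ^ Suc d)"
        by (intro sum.cong refl) (simp only: mass_rep atMost_iff)
      also have "\<dots> = fps_const x * u * A $ k + u * (\<Sum>d\<le>k. \<Sum>b\<le>k. \<beta> b * of_bool (d < b) * u ^ d)"
        unfolding A_def fps_nth_Abs_fps
        by (simp add: distrib_left distrib_right sum.distrib sum_distrib_left sum_distrib_right mult_ac
              del: walk_weight.simps sum_mult_of_bool_eq sum_of_bool_mult_eq)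
      also have "(\<Sum>d\<le>k. \<Sum>b\<le>k. \<beta> b * of_bool (d < b) * u ^ d) = (\<Sum>b\<le>k. \<beta> b * (\<Sum>d\<le>k. of_bool (d < b) * u ^ d))"
        by (subst sum.swap) (simp add: sum_distrib_left mult_ac del: sum_mult_of_bool_eq sum_of_bool_mult_eq)
      also have "\<dots> = (\<Sum>b\<le>k. \<beta> b * (\<Sum>d<b. u ^ d))"
      proof (intro sum.cong refl)
        fix b assume b: "b \<in> {..k}"
        have "(\<Sum>d\<le>k. of_bool (d < b) * u ^ d) = (\<Sum>d<b. u ^ d)"
          by (intro sum.mono_neutral_cong_right) (use b in auto)
        thus "\<beta> b * (\<Sum>d\<le>k. of_bool (d < b) * u ^ d) = \<beta> b * (\<Sum>d<b. u ^ d)" by simp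
      qed
      finally have "fps_X * A $ n = fps_const x * u * fps_X * A $ k + u * (\<Sum>b\<le>k. \<beta> b * (fps_X * (\<Sum>d<b. u ^ d)))"
        by (simp add: distrib_left sum_distrib_left mult_ac)
      also have "(\<Sum>b\<le>k. \<beta> b * (fps_X * (\<Sum>d<b. u ^ d))) = (\<Sum>b\<le>k. \<beta> b * (u ^ b - 1))"
        by (simp add: power_diff_1_eq u_def)
      also have "\<dots> = A $ k + (T * L) $ k - L $ k"
        by (simp add: right_diff_distrib sum_subtractf sum_\<beta> sum_\<beta>u)
      also have "T * L = z * L * R" by (simp add: TR mult_ac)
      finally have main: "fps_X * A $ n = fps_const x * u * fps_X * A $ k + u * (A $ k + (z * L * R) $ k - L $ k)" .
      have "(v + c * z * (1 + v) * v * A + z * (1 + v) * (A + z * L * R - L)) =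
         v + z * (fps_const (fps_const x * u * fps_X) * A) + z * (fps_const u * (A + z * L * R - L))"
        unfolding one_v by (simp add: c_def v_def mult_ac flip: fps_const_mult)
      also have "\<dots> $ n = fps_const x * u * fps_X * A $ k + u * (A $ k + (z * L * R) $ k - L $ k)"
        unfolding z_def Suc by (simp add: v_def)
      finally show ?thesis using main by (simp add: v_def)
    qed
  qed
  thus thesis unfolding AR L_def by (rule that)
qed

section \<open>Growth of the walk generating function\<close>

lemma walk_gf_system:
  obtains V W J :: "real fps" where
    "V = fps_X * (1 + V) + fps_const x * fps_X * V * (1 + V) + fps_X * V * J * J"
    "W = fps_X * J + fps_const x * fps_X * W * (1 + V) * (1 + V)"
    "J = 1 + W * J"
    "fps_X * walk_gf x = W * (1 - fps_const x * V * V)"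
  using walk_functional_equation[of x] kernel_method[of _ x "walk_gf x"] by metis

definition fps_nonneg_below :: "nat \<Rightarrow> real fps \<Rightarrow> bool" where
  "fps_nonneg_below n f \<longleftrightarrow> (\<forall>i<n. f $ i \<ge> 0)"

lemma fps_nonneg_below_add: "fps_nonneg_below n f \<Longrightarrow> fps_nonneg_below n g \<Longrightarrow> fps_nonneg_below n (f + g)"
  and fps_nonneg_below_mult: "fps_nonneg_below n f \<Longrightarrow> fps_nonneg_below n g \<Longrightarrow> fps_nonneg_below n (f * g)"
  and fps_nonneg_below_1: "fps_nonneg_below n 1"
  and fps_nonneg_below_const: "x \<ge> 0 \<Longrightarrow> fps_nonneg_below n (fps_const x)"
  and fps_nonneg_below_X_mult: "fps_nonneg_below n f \<Longrightarrow> fps_nonneg_below (Suc n) (fps_X * f)"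
  by (auto simp: fps_nonneg_below_def fps_mult_nth intro!: sum_nonneg)

text \<open>Each series is expressed by the system through coefficients of smaller index, with nonnegative
  operations only.\<close>

lemma system_nonneg:
  fixes V W J :: "real fps" and x :: real
  assumes V: "V = fps_X * (1 + V) + fps_const x * fps_X * V * (1 + V) + fps_X * V * J * J"
    and W: "W = fps_X * J + fps_const x * fps_X * W * (1 + V) * (1 + V)"
    and J: "J = 1 + W * J" and x: "x \<ge> 0"
  shows "V $ n \<ge> 0" "W $ n \<ge> 0" "J $ n \<ge> 0"
proof -
  define V' where "V' = 1 + V + fps_const x * V * (1 + V) + V * J * J"
  define W' where "W' = J + fps_const x * W * (1 + V) * (1 + V)"
  have V': "V = fps_X * V'" using V unfolding V'_def by algebra
  have W': "W = fps_X * W'" using W unfolding W'_def by algebra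
  have J': "J = 1 + fps_X * (W' * J)" using J W' by algebra
  have "fps_nonneg_below n V \<and> fps_nonneg_below n W \<and> fps_nonneg_below n J" for n
  proof (induction n)
    case 0 show ?case by (simp add: fps_nonneg_below_def)
  next
    case (Suc n)
    note nn = fps_nonneg_below_add fps_nonneg_below_mult fps_nonneg_below_1
      fps_nonneg_below_const[OF x]
    have "fps_nonneg_below n V'" "fps_nonneg_below n W'" "fps_nonneg_below n (W' * J)"
      using Suc unfolding V'_def W'_def by (auto intro!: nn)
    thus ?case
      using V' W' J' fps_nonneg_below_X_mult fps_nonneg_below_add[OF fps_nonneg_below_1] by metis
  qed
  from this[of "Suc n"] show "V $ n \<ge> 0" "W $ n \<ge> 0" "J $ n \<ge> 0"
    by (auto simp: fps_nonneg_below_def)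
qed

text \<open>The partial sums of \<open>f\<close> at \<open>y\<close> are used in place of the value \<open>f(y)\<close>, so that bounds on them can
  be proved by induction before convergence is known.\<close>

definition fps_psum :: "real \<Rightarrow> nat \<Rightarrow> real fps \<Rightarrow> real" where
  "fps_psum y N f = (\<Sum>i<N. f $ i * y ^ i)"

lemma fps_psum_add: "fps_psum y N (f + g) = fps_psum y N f + fps_psum y N g"
  by (simp add: fps_psum_def sum.distrib algebra_simps)

lemma fps_psum_const_mult: "fps_psum y N (fps_const c * f) = c * fps_psum y N f"
  by (simp add: fps_psum_def sum_distrib_left mult_ac)

lemma fps_psum_X_mult: "fps_psum y (Suc N) (fps_X * f) = y * fps_psum y N f"
  unfolding fps_psum_def by (subst sum.lessThan_Suc_shift) (simp add: sum_distrib_left mult_ac)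

lemma fps_psum_1_le: "fps_psum y N 1 \<le> 1"
proof -
  have "fps_psum y N 1 = (\<Sum>i<N. if i = 0 then 1 else 0)"
    unfolding fps_psum_def by (intro sum.cong) auto
  thus ?thesis by (simp add: sum.delta)
qed

lemma fps_psum_nonneg: "(\<And>n. f $ n \<ge> 0) \<Longrightarrow> y \<ge> 0 \<Longrightarrow> fps_psum y N f \<ge> 0"
  by (auto simp: fps_psum_def intro!: sum_nonneg)

lemma fps_psum_mult_le:
  assumes f: "\<And>n. f $ n \<ge> 0" and g: "\<And>n. g $ n \<ge> 0" and y: "y \<ge> 0"
  shows "fps_psum y N (f * g) \<le> fps_psum y N f * fps_psum y N g"
proof -
  have "fps_psum y N (f * g) = (\<Sum>n<N. \<Sum>i\<le>n. (f $ i * y ^ i) * (g $ (n - i) * y ^ (n - i)))"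
    unfolding fps_psum_def fps_mult_nth sum_distrib_right atLeast0AtMost
    by (intro sum.cong refl) (simp add: mult_ac flip: power_add)
  also have "\<dots> = (\<Sum>(i,j)\<in>{(i,j). i + j < N}. (f $ i * y ^ i) * (g $ j * y ^ j))"
    by (rule sum.triangle_reindex[symmetric])
  also have "\<dots> \<le> (\<Sum>(i,j)\<in>{..<N} \<times> {..<N}. (f $ i * y ^ i) * (g $ j * y ^ j))"
    using f g y by (intro sum_mono2) auto
  also have "\<dots> = fps_psum y N f * fps_psum y N g"
    by (simp add: fps_psum_def sum_product sum.cartesian_product)
  finally show ?thesis .
qed

text \<open>The system is monotone: if \<open>v\<close>, \<open>w\<close>, \<open>j\<close> satisfy it at \<open>z = y\<close> as inequalities, then they bound all
  partial sums of its solution, by induction on the length of the sums.\<close>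

lemma system_bound:
  fixes V W J :: "real fps" and x :: real
  assumes V: "V = fps_X * (1 + V) + fps_const x * fps_X * V * (1 + V) + fps_X * V * J * J"
    and W: "W = fps_X * J + fps_const x * fps_X * W * (1 + V) * (1 + V)"
    and J: "J = 1 + W * J" and x: "x \<ge> 0" and y: "y \<ge> 0"
    and v: "v \<ge> 0" "y * (1 + v) + x * y * v * (1 + v) + y * v * j * j \<le> v"
    and w: "w \<ge> 0" "y * j + x * y * w * (1 + v) * (1 + v) \<le> w"
    and j: "j \<ge> 0" "1 + w * j \<le> j"
  shows "fps_psum y N V \<le> v" "fps_psum y N W \<le> w"
proof -
  note nn = system_nonneg[OF V W J x]
  define W' where "W' = J + fps_const x * W * (1 + V) * (1 + V)"
  have V': "V = fps_X * ((1 + V) + fps_const x * (V * (1 + V)) + V * (J * J))"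
    using V by algebra
  have W': "W = fps_X * W'" using W unfolding W'_def by algebra
  have W'': "W' = J + fps_const x * (W * ((1 + V) * (1 + V)))" by (simp add: W'_def algebra_simps)
  have J': "J = 1 + fps_X * (W' * J)" using J W' by algebra
  have nn1: "(1 + V) $ n \<ge> 0" for n using nn(1)[of n] by (cases "n = 0") auto
  have nnm: "(\<And>n. f $ n \<ge> 0) \<Longrightarrow> (\<And>n. g $ n \<ge> 0) \<Longrightarrow> (f * g) $ n \<ge> 0" for f g :: "real fps" and n
    by (auto simp: fps_mult_nth intro!: sum_nonneg)
  have nnW': "W' $ n \<ge> 0" for n
    unfolding W'' using nn nn1 x by (auto intro!: nnm add_nonneg_nonneg mult_nonneg_nonneg)
  have mult: "fps_psum y N (f * g) \<le> a * b"
    if "fps_psum y N f \<le> a" "fps_psum y N g \<le> b" "\<And>n. f $ n \<ge> 0" "\<And>n. g $ n \<ge> 0" for f g N a b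
  proof -
    have "fps_psum y N (f * g) \<le> fps_psum y N f * fps_psum y N g"
      using that y by (intro fps_psum_mult_le)
    also have "\<dots> \<le> a * b"
      using that fps_psum_nonneg[OF that(3) y, of N] fps_psum_nonneg[OF that(4) y, of N]
      by (intro mult_mono) (auto intro: order_trans)
    finally show ?thesis .
  qed
  have "fps_psum y N V \<le> v \<and> fps_psum y N W \<le> w \<and> fps_psum y N J \<le> j"
  proof (induction N)
    case 0 thus ?case using v w j by (simp add: fps_psum_def)
  next
    case (Suc N)
    have V1: "fps_psum y N (1 + V) \<le> 1 + v"
      using Suc fps_psum_1_le[of y N] by (simp add: fps_psum_add)
    have "fps_psum y (Suc N) V = y * fps_psum y N ((1 + V) + fps_const x * (V * (1 + V)) + V * (J * J))"
      by (subst V') (rule fps_psum_X_mult)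
    also have "\<dots> = y * (fps_psum y N (1 + V) + x * fps_psum y N (V * (1 + V)) + fps_psum y N (V * (J * J)))"
      unfolding fps_psum_add[of _ _ "_ + _ * _"] fps_psum_add[of _ _ "1 + V" "_ * _"] fps_psum_const_mult by simp
    also have "\<dots> \<le> y * ((1 + v) + x * (v * (1 + v)) + v * (j * j))"
      using Suc V1 nn nn1 x y by (intro mult_left_mono add_mono mult) (auto intro!: nnm)
    also have "\<dots> \<le> v" using v by (simp add: algebra_simps)
    finally have cV: "fps_psum y (Suc N) V \<le> v" .
    have "fps_psum y N W' = fps_psum y N J + x * fps_psum y N (W * ((1 + V) * (1 + V)))"
      unfolding W'' fps_psum_add fps_psum_const_mult ..
    also have "\<dots> \<le> j + x * (w * ((1 + v) * (1 + v)))"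
      using Suc V1 nn nn1 x y by (intro mult_left_mono add_mono mult) (auto intro!: nnm)
    finally have W1: "y * fps_psum y N W' \<le> w"
      using w mult_left_mono[OF _ y] by (fastforce simp: algebra_simps)
    hence cW: "fps_psum y (Suc N) W \<le> w"
      by (subst W') (simp add: fps_psum_X_mult)
    have "fps_psum y (Suc N) J = fps_psum y (Suc N) 1 + y * fps_psum y N (W' * J)"
      by (subst J') (simp add: fps_psum_add fps_psum_X_mult)
    also have "\<dots> \<le> 1 + y * (fps_psum y N W' * j)"
      using Suc nn nnW' y by (intro add_mono fps_psum_1_le mult_left_mono mult) auto
    also have "\<dots> \<le> 1 + w * j"
      using mult_right_mono[OF W1 j(1)] by (simp add: mult_ac)
    also have "\<dots> \<le> j" by (rule j)
    finally show ?case using cV cW by simp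
  qed
  thus "fps_psum y N V \<le> v" "fps_psum y N W \<le> w" by auto
qed

text \<open>Since \<open>z D = W - x W V\<^sup>2\<close>, the coefficients of \<open>D\<close> are at most those of \<open>W / z\<close>.\<close>

lemma walk_gf_upper_bound:
  assumes x: "x \<ge> 0" and y: "y > 0"
    and v: "v \<ge> 0" "y * (1 + v) + x * y * v * (1 + v) + y * v * j * j \<le> v"
    and w: "w \<ge> 0" "y * j + x * y * w * (1 + v) * (1 + v) \<le> w"
    and j: "j \<ge> 0" "1 + w * j \<le> j"
  shows "walk_gf x $ n \<le> w / y ^ Suc n"
proof -
  obtain V W J where V: "V = fps_X * (1 + V) + fps_const x * fps_X * V * (1 + V) + fps_X * V * J * J"
    and W: "W = fps_X * J + fps_const x * fps_X * W * (1 + V) * (1 + V)"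
    and J: "J = 1 + W * J" and Q: "fps_X * walk_gf x = W * (1 - fps_const x * V * V)"
    by (rule walk_gf_system)
  note nn = system_nonneg[OF V W J x]
  have nnm: "(\<And>n. f $ n \<ge> 0) \<Longrightarrow> (\<And>n. g $ n \<ge> 0) \<Longrightarrow> (f * g) $ n \<ge> 0" for f g :: "real fps" and n
    by (auto simp: fps_mult_nth intro!: sum_nonneg)
  have "walk_gf x $ n = (fps_X * walk_gf x) $ Suc n" by simp
  also have "fps_X * walk_gf x = W - fps_const x * (W * (V * V))"
    unfolding Q by (simp add: algebra_simps)
  also have "\<dots> $ Suc n = W $ Suc n - x * (W * (V * V)) $ Suc n" by simp
  also have "\<dots> \<le> W $ Suc n"
    using mult_nonneg_nonneg[OF x nnm[OF nn(2) nnm[OF nn(1) nn(1)]], of "Suc n"] by simp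
  finally have "walk_gf x $ n * y ^ Suc n \<le> W $ Suc n * y ^ Suc n"
    using y by (intro mult_right_mono) auto
  also have "\<dots> \<le> fps_psum y (Suc (Suc n)) W"
    unfolding fps_psum_def using nn y by (intro member_le_sum) auto
  also have "\<dots> \<le> w"
    using system_bound(2)[OF V W J x _ v w j] y by simp
  finally show ?thesis using y by (simp add: field_simps)
qed

text \<open>The coefficients are supermultiplicative up to a shift of the index, so it suffices to find a
  single \<open>k\<close> for which the coefficient is at least \<open>k\<^sub>0\<^sup>k\<^sup>+\<^sup>1\<close>, where \<open>l < k\<^sub>0 < 27/4\<close>. Without such a \<open>k\<close> the
  series would converge at some \<open>y > 4/27\<close> to a number \<open>G \<ge> 0\<close> with \<open>G = 1 + y G\<^sup>3\<close>; but
  \<open>1 + 4/27 G\<^sup>3 - G = 4/27 (G - 3/2)\<^sup>2 (G + 3)\<close> is nonnegative, so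
  \<open>1 + y G\<^sup>3 > G\<close>.\<close>

lemma ternary_growth:
  fixes g :: "real fps"
  assumes g: "g = 1 + fps_X * g ^ 3" and nn: "\<And>n. g $ n \<ge> 0" and l: "0 < l" "l < 27 / 4"
  shows "eventually (\<lambda>n. g $ n \<ge> l ^ n) sequentially"
proof -
  have g0: "g $ 0 = 1" by (subst g) simp
  have nng2: "(g * g) $ n \<ge> 0" for n using nn by (auto simp: fps_mult_nth intro!: sum_nonneg)
  have super: "g $ Suc (n + m) \<ge> g $ n * g $ m" for n m
  proof -
    have "g $ n * g $ m \<le> (g * g) $ (n + m)"
      unfolding fps_mult_nth using member_le_sum[of n "{0..n+m}" "\<lambda>i. g $ i * g $ (n + m - i)"] nn by simp
    also have "\<dots> = (g * g) $ (n + m) * g $ (n + m - (n + m))" by (simp add: g0)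
    also have "\<dots> \<le> (g * g * g) $ (n + m)"
      unfolding fps_mult_nth[of "g * g" g]
      using member_le_sum[of "n+m" "{0..n+m}" "\<lambda>i. (g * g) $ i * g $ (n + m - i)"] nn nng2 by simp
    also have "\<dots> = g $ Suc (n + m)" by (subst (4) g) (simp add: power3_eq_cube)
    finally show ?thesis .
  qed
  define k0 where "k0 = (l + 27 / 4) / 2"
  define k1 where "k1 = (k0 + 27 / 4) / 2"
  have k: "l < k0" "k0 < k1" "k1 < 27 / 4" "k0 > 0" "k1 > 0" using l unfolding k0_def k1_def by - (simp add: field_simps)+
  have "\<exists>k. g $ k \<ge> k0 ^ Suc k"
  proof (rule ccontr)
    assume "\<not> ?thesis"
    hence bd: "g $ k \<le> k0 ^ Suc k" for k by (meson linear)
    define y where "y = 1 / k1"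
    have rad: "fps_conv_radius g \<ge> 1 / ((k0 + k1) / 2)"
    proof -
      have "summable (\<lambda>n. g $ n * (1 / ((k0 + k1) / 2)) ^ n)"
      proof (rule summable_comparison_test')
        show "summable (\<lambda>n. k0 * (k0 / ((k0 + k1) / 2)) ^ n)"
          using k by (intro summable_mult summable_geometric) auto
        fix n :: nat assume "n \<ge> 0"
        have "g $ n * (1 / ((k0 + k1) / 2)) ^ n \<le> k0 ^ Suc n * (1 / ((k0 + k1) / 2)) ^ n"
          using k by (intro mult_right_mono bd) auto
        thus "norm (g $ n * (1 / ((k0 + k1) / 2)) ^ n) \<le> k0 * (k0 / ((k0 + k1) / 2)) ^ n"
          using nn[of n] k by (simp add: abs_mult power_divide mult_ac)
      qed
      from conv_radius_geI[OF this] show ?thesis using k by (simp add: fps_conv_radius_def)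
    qed
    have "1 / k1 < 1 / ((k0 + k1) / 2)" using k by (simp add: field_simps)
    hence "ereal (norm y) < 1 / ((k0 + k1) / 2)" using k by (simp add: y_def)
    hence r: "ereal (norm y) < fps_conv_radius g" using rad by (rule less_le_trans)
    define G where "G = eval_fps g y"
    have r3: "ereal (norm y) < fps_conv_radius (g ^ 3)"
      using r fps_conv_radius_power[of g 3] by (rule less_le_trans)
    have rX: "ereal (norm y) < fps_conv_radius (fps_X * g ^ 3)"
      using r3 fps_conv_radius_mult[of fps_X "g ^ 3"] by (simp add: less_le_trans)
    have "G = eval_fps (1 + fps_X * g ^ 3) y" unfolding G_def using g by simp
    also have "\<dots> = 1 + y * G ^ 3"
      using r r3 rX by (simp add: eval_fps_add eval_fps_mult eval_fps_power G_def)
    finally have eq: "G = 1 + y * G ^ 3" .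
    have G0: "G \<ge> 0" unfolding G_def eval_fps_def
      using nn k summable_fps[OF r] by (intro suminf_nonneg) (auto simp: y_def)
    have "y > 4 / 27" using k by (simp add: y_def field_simps)
    moreover have "G \<noteq> 0" using eq by auto
    ultimately have "y * G ^ 3 > 4 / 27 * G ^ 3" using G0 by (intro mult_strict_right_mono) auto
    moreover have "1 + 4 / 27 * G ^ 3 - G = 4 / 27 * ((G - 3 / 2) ^ 2 * (G + 3))"
      by (simp add: power2_eq_square power3_eq_cube algebra_simps)
    moreover have "\<dots> \<ge> 0" using G0 by simp
    ultimately show False using eq by linarith
  qed
  then obtain k where k': "g $ k \<ge> k0 ^ Suc k" by blast
  define p where "p = Suc k"
  define a where "a n = g $ (n - 1)" for n
  have mono: "a n \<le> a m" if "1 \<le> n" "n \<le> m" for n m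
  proof -
    have "incseq (\<lambda>n. g $ n)"
      using super[of 0] g0 by (intro incseq_SucI) simp
    from incseqD[OF this, of "n - 1" "m - 1"] show ?thesis unfolding a_def using that by simp
  qed
  have powers: "a (Suc q * p) \<ge> (k0 ^ p) ^ Suc q" for q
  proof (induction q)
    case 0 thus ?case using k' by (simp add: a_def p_def)
  next
    case (Suc q)
    have "(k0 ^ p) ^ Suc (Suc q) \<le> a (Suc q * p) * a p"
      using Suc k' k mult_mono[of "(k0 ^ p) ^ Suc q" "a (Suc q * p)" "k0 ^ p" "a p"] nn
      by (simp add: a_def p_def mult_ac)
    also have "\<dots> \<le> a (Suc q * p + p)"
      using super[of "Suc q * p - 1" "p - 1"] by (simp add: a_def p_def)
    finally show ?case by (simp add: add_ac)
  qed
  have lower: "g $ n \<ge> 1 / (k0 + 1) ^ p * k0 ^ n" if "n \<ge> p" for n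
  proof -
    have p0: "p > 0" by (simp add: p_def)
    have "n div p > 0" using that p0 by (simp add: div_greater_zero_iff)
    then obtain q where q: "n div p = Suc q" using gr0_implies_Suc by blast
    have nq: "n = Suc q * p + n mod p" using q by (metis div_mult_mod_eq)
    have "k0 ^ n = (k0 ^ p) ^ Suc q * k0 ^ (n mod p)"
      by (subst nq) (simp add: power_add power_mult[symmetric] mult_ac)
    also have "k0 ^ (n mod p) \<le> (k0 + 1) ^ p"
    proof -
      have "k0 ^ (n mod p) \<le> (k0 + 1) ^ (n mod p)" using k by (intro power_mono) auto
      also have "\<dots> \<le> (k0 + 1) ^ p" using p0 k by (intro power_increasing) auto
      finally show ?thesis .
    qed
    finally have "k0 ^ n \<le> (k0 ^ p) ^ Suc q * (k0 + 1) ^ p" using k by simp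
    hence "k0 ^ n / (k0 + 1) ^ p \<le> (k0 ^ p) ^ Suc q" using k by (simp add: divide_le_eq)
    also have "\<dots> \<le> a (Suc q * p)" by (rule powers)
    also have "\<dots> \<le> a (Suc n)" using nq p0 by (intro mono) auto
    also have "\<dots> = g $ n" by (simp add: a_def)
    finally show ?thesis by simp
  qed
  define C where "C = 1 / (k0 + 1) ^ p"
  have "C > 0" using k by (simp add: C_def)
  have "(\<lambda>n. (l / k0) ^ n) \<longlonglongrightarrow> 0" using k l by (intro LIMSEQ_power_zero) auto
  hence "eventually (\<lambda>n. (l / k0) ^ n < C) sequentially" using \<open>C > 0\<close> by (rule order_tendstoD)
  thus ?thesis using eventually_ge_at_top[of p]
  proof eventually_elim
    case (elim n)
    have "l ^ n = (l / k0) ^ n * k0 ^ n" using k by (simp add: power_divide)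
    also have "\<dots> \<le> C * k0 ^ n" using elim k by (intro mult_right_mono) auto
    also have "\<dots> \<le> g $ n" unfolding C_def by (rule lower) (use elim in auto)
    finally show ?case .
  qed
qed

text \<open>At \<open>x = 1\<close> the system has the symmetry \<open>1 + V = 1/(1 - W)\<close>. The common value \<open>g\<close> satisfies
  \<open>g = 1 + z g\<^sup>3\<close>, and then \<open>z D = (g - 1) (2 - g)\<close> has the derivative \<open>g\<^sup>4\<close>, whose coefficients are at
  least those of \<open>g\<close>. The differentiation costs only the factor \<open>n + 1\<close>.\<close>

lemma walk_gf_lower_bound:
  assumes l: "0 < l" "l < 27 / 4"
  shows "eventually (\<lambda>n. l ^ n \<le> real (Suc n) * walk_gf 1 $ n) sequentially"
proof -
  obtain V W J where V: "V = fps_X * (1 + V) + fps_const 1 * fps_X * V * (1 + V) + fps_X * V * J * J"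
    and W: "W = fps_X * J + fps_const 1 * fps_X * W * (1 + V) * (1 + V)"
    and J: "J = 1 + W * J" and Q: "fps_X * walk_gf 1 = W * (1 - fps_const 1 * V * V)"
    by (rule walk_gf_system)
  define g where "g = 1 + V"
  have V_nonneg: "V $ n \<ge> 0" for n by (rule system_nonneg(1)[OF V W J]) simp
  \<comment> \<open>The equations for \<open>g\<close> and \<open>J = 1/(1 - W)\<close> are exchanged by swapping \<open>g\<close> and \<open>J\<close>; their
    difference has the factor \<open>g - J\<close>, and the other factor is invertible.\<close>
  have "(g - J) * (1 - fps_X * (2 * (g + J) - g * J)) = 0"
  proof -
    have "g - 1 = fps_X * g * g + fps_X * (g - 1) * J * J"
      unfolding g_def by (subst V) (simp add: algebra_simps)
    moreover have "J - 1 = fps_X * J * J + fps_X * (J - 1) * g * g"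
    proof -
      have "J - 1 = W * J" using J by algebra
      also have "W * J = fps_X * J * J + fps_X * (W * J) * g * g"
        unfolding g_def by (subst W) (simp add: algebra_simps)
      finally show ?thesis using \<open>J - 1 = W * J\<close> by metis
    qed
    ultimately show ?thesis by algebra
  qed
  moreover have "(1 - fps_X * (2 * (g + J) - g * J)) $ 0 = 1" by simp
  hence "1 - fps_X * (2 * (g + J) - g * J) \<noteq> 0" by (metis fps_zero_nth zero_neq_one)
  ultimately have gJ: "J = g" by simp
  have g: "g = 1 + fps_X * g ^ 3"
  proof -
    have "V = fps_X * (1 + V) + fps_X * V * (1 + V) + fps_X * V * J * J" using V by simp
    thus ?thesis unfolding gJ g_def by algebra
  qed
  have Wg: "W * g = g - 1" using J gJ by algebra
  have Q': "fps_X * walk_gf 1 = (g - 1) * (2 - g)"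
    unfolding Q using Wg unfolding g_def fps_const_1_eq_1 by algebra
  have dg: "fps_deriv g = g ^ 3 + 3 * fps_X * g ^ 2 * fps_deriv g"
    by (subst g) (simp add: fps_deriv_power algebra_simps power3_eq_cube power2_eq_square)
  have "fps_deriv (fps_X * walk_gf 1) = fps_deriv g * (3 - 2 * g)"
    unfolding Q' by (simp add: algebra_simps)
  also have "\<dots> = g ^ 4" using dg g by algebra
  finally have "fps_deriv (fps_X * walk_gf 1) $ n = (g ^ 4) $ n" for n by simp
  hence Qn: "real (Suc n) * walk_gf 1 $ n = (g ^ 4) $ n" for n
    by (simp del: fps_deriv_mult)
  have g_nonneg: "g $ n \<ge> 0" for n using V_nonneg[of n] by (cases "n = 0") (auto simp: g_def)
  have g0: "g $ 0 = 1" by (subst g) simp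
  have "(g ^ 4) $ n \<ge> g $ n" for n
  proof -
    have nn3: "(g ^ 3) $ m \<ge> 0" for m
      using g_nonneg by (auto simp: power3_eq_cube fps_mult_nth intro!: sum_nonneg mult_nonneg_nonneg)
    have "g $ n = g $ n * (g ^ 3) $ (n - n)" using g0 by (simp add: fps_power_zeroth)
    also have "\<dots> \<le> (g * g ^ 3) $ n"
      unfolding fps_mult_nth[of g]
      using member_le_sum[of n "{0..n}" "\<lambda>i. g $ i * (g ^ 3) $ (n - i)"] g_nonneg nn3 by simp
    also have "g * g ^ 3 = g ^ 4" by (simp add: power_numeral_reduce)
    finally show ?thesis .
  qed
  hence "real (Suc n) * walk_gf 1 $ n \<ge> g $ n" for n using Qn by simp
  with ternary_growth[OF g g_nonneg l] show ?thesis
    by (elim eventually_mono) (rule order_trans)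
qed

text \<open>For large \<open>n\<close> the upper bound \<open>w / y\<^sup>n\<^sup>+\<^sup>1\<close> for the numerator is compared with the lower bound
  \<open>l\<^sup>n / (n + 1)\<close> for the denominator, with \<open>l < 27/4\<close> chosen such that still \<open>l y s > 1\<close>.\<close>

lemma tilted_gf_ratio:
  assumes x: "x > 0" and y: "y > 0"
    and v: "v \<ge> 0" "y * (1 + v) + x * y * v * (1 + v) + y * v * j * j \<le> v"
    and w: "w \<ge> 0" "y * j + x * y * w * (1 + v) * (1 + v) \<le> w"
    and j: "j \<ge> 0" "1 + w * j \<le> j"
    and t: "27 / 4 * y * s > 1" and s: "s > 0"
  shows "(\<lambda>n. walk_gf x $ n / s ^ n / walk_gf 1 $ n) \<longlonglongrightarrow> 0"
proof -
  \<comment> \<open>Any number strictly between \<open>1 / (y s)\<close> and \<open>27 / 4\<close> works.\<close>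
  define l where "l = (27 / 4 + 1 / (y * s)) / 2"
  have ys: "y * s > 0" using y s by simp
  have "1 / (y * s) < 27 / 4" "1 / (y * s) > 0"
    using t ys by (simp_all add: pos_divide_less_eq mult_ac)
  moreover have "0 < (27 / 4 + a) / 2 \<and> (27 / 4 + a) / 2 < 27 / 4 \<and> (27 / 4 + a) / 2 > a"
    if "a < 27 / 4" "a > 0" for a :: real
    using that by simp
  ultimately have l: "0 < l" "l < 27 / 4" "l > 1 / (y * s)" unfolding l_def by blast+
  have r: "0 < 1 / (y * s * l)" "1 / (y * s * l) < 1" using l y s by (auto simp: field_simps)
  have "(\<lambda>n. real n * (1 / (y * s * l)) ^ n) \<longlonglongrightarrow> 0"
    using r by (intro powser_times_n_limit_0) auto
  moreover have "(\<lambda>n. (1 / (y * s * l)) ^ n) \<longlonglongrightarrow> 0"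
    using r by (intro LIMSEQ_power_zero) auto
  ultimately have "(\<lambda>n. w / y * (real n * (1 / (y * s * l)) ^ n + (1 / (y * s * l)) ^ n)) \<longlonglongrightarrow> w / y * (0 + 0)"
    by (intro tendsto_mult_left tendsto_add)
  hence lim: "(\<lambda>n. w / y * (real n * (1 / (y * s * l)) ^ n + (1 / (y * s * l)) ^ n)) \<longlonglongrightarrow> 0" by simp
  have mass_nn: "walk_weight x n w \<ge> 0" if "x \<ge> 0" for x n w
  proof (induction n arbitrary: w)
    case (Suc n)
    have "step_weight x w w' \<ge> 0" for w w' using that by (cases "(x, w, w')" rule: step_weight.cases) auto
    thus ?case using Suc by (auto intro!: sum_nonneg mult_nonneg_nonneg)
  qed auto
  hence nn: "walk_gf x $ n \<ge> 0" if "x \<ge> 0" for x n using that by (auto simp: walk_gf_def intro!: sum_nonneg)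
  show ?thesis
  proof (rule tendsto_sandwich[OF _ _ tendsto_const lim])
    show "\<forall>\<^sub>F n in sequentially. 0 \<le> walk_gf x $ n / s ^ n / walk_gf 1 $ n"
      using nn[of x] nn[of 1] x s by (intro always_eventually allI divide_nonneg_nonneg) auto
    show "\<forall>\<^sub>F n in sequentially. walk_gf x $ n / s ^ n / walk_gf 1 $ n
        \<le> w / y * (real n * (1 / (y * s * l)) ^ n + (1 / (y * s * l)) ^ n)"
      using walk_gf_lower_bound[OF l(1,2)]
    proof eventually_elim
      case (elim n)
      have "walk_gf x $ n / s ^ n / walk_gf 1 $ n \<le> (w / y ^ Suc n) / s ^ n / (l ^ n / real (Suc n))"
      proof (intro frac_le divide_right_mono)
        show "walk_gf x $ n \<le> w / y ^ Suc n" using x by (intro walk_gf_upper_bound[OF _ y v w j]) auto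
        show "l ^ n / real (Suc n) \<le> walk_gf 1 $ n" using elim by (simp add: field_simps)
      qed (use w y s l in auto)
      also have "\<dots> = w / y * (real n * (1 / (y * s * l)) ^ n + (1 / (y * s * l)) ^ n)"
        using y s l by (simp add: field_simps power_mult_distrib)
      finally show ?case .
    qed
  qed
qed

text \<open>The supersolution used for \<open>x = 1 + d\<close> is \<open>v = 1/2 - d/8\<close>, \<open>w = 1/3\<close>, \<open>j = 3/2\<close> at
  \<open>y = 4/27 (1 - 5/18 d - \<eta> \<bar>d\<bar>)\<close>. At the critical point the linearization of the system is singular,
  with left kernel spanned by \<open>(2, 3)\<close>; solvability of the linearized equations forces the coefficient
  \<open>5/18\<close>, and \<open>v\<close> and \<open>w\<close> above solve them. The term \<open>\<eta> \<bar>d\<bar>\<close> creates the slack that turns the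
  equations into inequalities.\<close>

lemma near_critical_ratio:
  fixes c :: real
  defines "c \<equiv> 5 / 18"
  assumes \<eta>: "0 < \<eta>" "\<eta> \<le> 1 / 4" and d: "\<bar>d\<bar> < 1"
    and s: "(1 - c * d - \<eta> * \<bar>d\<bar>) * s > 1" "s > 0"
  shows "(\<lambda>n. walk_gf (1 + d) $ n / s ^ n / walk_gf 1 $ n) \<longlonglongrightarrow> 0"
proof -
  define e where "e = 1 - c * d - \<eta> * \<bar>d\<bar>"
  have "\<eta> * \<bar>d\<bar> \<le> 1 / 4 * 1" using \<eta> d by (intro mult_mono) auto
  hence e: "e > 0" using d unfolding e_def c_def by (simp add: abs_if split: if_splits)
  have cube: "d ^ 3 \<le> d ^ 2"
  proof -
    have "d ^ 3 = d ^ 2 * d" by (simp add: power3_eq_cube power2_eq_square)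
    also have "\<dots> \<le> d ^ 2 * 1" using d by (intro mult_left_mono) auto
    finally show ?thesis by simp
  qed
  have c0: "c > 0" by (simp add: c_def)
  have pos: "\<eta> * \<bar>d\<bar> * (1 + k * d) \<ge> 0" if "0 \<le> k" "k \<le> 1" for k
  proof -
    have "\<bar>k * d\<bar> \<le> 1 * 1" using that d unfolding abs_mult by (intro mult_mono) auto
    hence "1 + k * d \<ge> 0" by (simp add: abs_le_iff)
    thus ?thesis using \<eta> by simp
  qed
  show ?thesis
  proof (rule tilted_gf_ratio[where y = "4 / 27 * e" and v = "1 / 2 - d / 8" and w = "1 / 3" and j = "3 / 2"])
    \<comment> \<open>The inequality for \<open>w\<close>.\<close>
    have "4 / 27 * e * (3 / 2) + (1 + d) * (4 / 27 * e) * (1 / 3) * (1 + (1 / 2 - d / 8)) * (1 + (1 / 2 - d / 8))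
      = 1 / 3 * (e * (1 + c * d)) - e * (23 * d ^ 2 - d ^ 3) / 1296"
      by (simp add: c_def field_simps power2_eq_square power3_eq_cube)
    also have "\<dots> \<le> 1 / 3 * (e * (1 + c * d))"
    proof -
      have "23 * d ^ 2 - d ^ 3 \<ge> 0" using cube zero_le_power2[of d] by linarith
      thus ?thesis using e by simp
    qed
    also have "e * (1 + c * d) = 1 - (c * d) ^ 2 - \<eta> * \<bar>d\<bar> * (1 + c * d)"
      by (simp add: e_def algebra_simps power2_eq_square)
    also have "\<dots> \<le> 1"
    proof -
      have "c \<le> 1" by (simp add: c_def)
      thus ?thesis using pos[of c] c0 zero_le_power2[of "c * d"] by linarith
    qed
    finally show "4 / 27 * e * (3 / 2) + (1 + d) * (4 / 27 * e) * (1 / 3) * (1 + (1 / 2 - d / 8)) * (1 + (1 / 2 - d / 8)) \<le> 1 / 3"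
      by simp
  next
    \<comment> \<open>The inequality for \<open>v\<close>.\<close>
    have "4 / 27 * e * (1 + (1 / 2 - d / 8)) + (1 + d) * (4 / 27 * e) * (1 / 2 - d / 8) * (1 + (1 / 2 - d / 8))
        + 4 / 27 * e * (1 / 2 - d / 8) * (3 / 2) * (3 / 2)
      = 1 / 2 * (e * (1 + d / 36)) - e * (15 * d ^ 2 - d ^ 3) / 432"
      by (simp add: field_simps power2_eq_square power3_eq_cube)
    also have "\<dots> \<le> 1 / 2 * (e * (1 + d / 36))"
    proof -
      have "15 * d ^ 2 - d ^ 3 \<ge> 0" using cube zero_le_power2[of d] by linarith
      thus ?thesis using e by simp
    qed
    also have "e * (1 + d / 36) = 1 - d / 4 - c / 36 * d ^ 2 - \<eta> * \<bar>d\<bar> * (1 + 1 / 36 * d)"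
      by (simp add: e_def c_def field_simps power2_eq_square)
    also have "\<dots> \<le> 1 - d / 4" 
    proof -
      have "\<eta> * \<bar>d\<bar> * (1 + 1 / 36 * d) \<ge> 0" by (rule pos) auto
      moreover have "c / 36 * d ^ 2 \<ge> 0" using c0 by simp
      ultimately show ?thesis by linarith
    qed
    also have "1 / 2 * (1 - d / 4) = 1 / 2 - d / 8" by simp
    finally show "4 / 27 * e * (1 + (1 / 2 - d / 8)) + (1 + d) * (4 / 27 * e) * (1 / 2 - d / 8) * (1 + (1 / 2 - d / 8))
        + 4 / 27 * e * (1 / 2 - d / 8) * (3 / 2) * (3 / 2) \<le> 1 / 2 - d / 8"
      by simp
  next
    have "27 / 4 * (4 / 27 * e) * s = e * s" by simp
    thus "27 / 4 * (4 / 27 * e) * s > 1" using s by (simp only: e_def)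
  qed (use e d s in auto)
qed

section \<open>Dominoes built by prepending points\<close>

text \<open>The height \<open>v\<close> is admissible for a new leftmost point in the top cell: it must not play the role of
  2 in a pattern 213 there.\<close>

definition top_site :: "nat \<Rightarrow> nat list \<Rightarrow> nat \<Rightarrow> bool" where
  "top_site r s v \<longleftrightarrow> \<not> (\<exists>a b. subseq [a, b] s \<and> r \<le> a \<and> a < v \<and> v \<le> b)"

text \<open>The height \<open>v\<close> is admissible for a new leftmost point in the bottom cell: it must not play the role
  of 1 in a pattern 132 there, nor in a pattern 1324 in which 1 and 2 lie in the bottom cell and 3 and
  4 in the top cell.\<close>

definition bottom_site :: "nat \<Rightarrow> nat list \<Rightarrow> nat \<Rightarrow> bool" where
  "bottom_site r s v \<longleftrightarrow> \<not> (\<exists>a b. subseq [a, b] s \<and> a < r \<and> b < a \<and> v \<le> b) \<and>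
     \<not> (\<exists>c b d. subseq [c, b, d] s \<and> r \<le> c \<and> c < d \<and> b < r \<and> v \<le> b)"

fun admissible :: "nat \<Rightarrow> nat list \<Rightarrow> bool" where
  "admissible r [] \<longleftrightarrow> True"
| "admissible r (v # s) \<longleftrightarrow> admissible r s \<and> (if r \<le> v then top_site r s v else bottom_site r s v)"

lemma subseq_Cons_right: "subseq ys (x # xs) \<longleftrightarrow> subseq ys xs \<or> (\<exists>zs. ys = x # zs \<and> subseq zs xs)"
  by (cases ys) (auto dest: subseq_Cons')

lemma subseq_setD: "subseq xs ys \<Longrightarrow> x \<in> set xs \<Longrightarrow> x \<in> set ys"
  by (erule list_emb_set) auto

lemma subseq_filter_iff: "subseq xs (filter P ys) \<longleftrightarrow> subseq xs ys \<and> (\<forall>x\<in>set xs. P x)"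
proof
  assume *: "subseq xs (filter P ys)"
  have "set xs \<subseteq> set (filter P ys)" using subseq_setD[OF *] by auto
  moreover have "subseq xs ys" using * subseq_filter_left by (rule subseq_order.trans)
  ultimately show "subseq xs ys \<and> (\<forall>x\<in>set xs. P x)" by auto
next
  assume "subseq xs ys \<and> (\<forall>x\<in>set xs. P x)"
  moreover from this have "filter P xs = xs" by (simp add: filter_id_conv)
  ultimately show "subseq xs (filter P ys)" using subseq_filter[of xs ys P] by simp
qed

lemma subseq_map_iff: "subseq xs (map f ys) \<longleftrightarrow> (\<exists>zs. subseq zs ys \<and> xs = map f zs)"
  by (auto simp: subseq_conv_nths nths_map)

lemma ex_subseq_map_pair:
  "(\<exists>a b. subseq [a, b] (map f s) \<and> P a b) \<longleftrightarrow> (\<exists>a b. subseq [a, b] s \<and> P (f a) (f b))"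
  unfolding subseq_map_iff by (auto simp: map_eq_Cons_conv) (metis list.simps(8,9))

lemma ex_subseq_map_triple:
  "(\<exists>a b c. subseq [a, b, c] (map f s) \<and> P a b c) \<longleftrightarrow> (\<exists>a b c. subseq [a, b, c] s \<and> P (f a) (f b) (f c))"
  unfolding subseq_map_iff by (auto simp: map_eq_Cons_conv) (metis list.simps(8,9))

lemma avoids_Cons:
  "avoids (x # xs) p \<longleftrightarrow> avoids xs p \<and> \<not> (\<exists>ys. subseq ys xs \<and> order_isomorphic (x # ys) p)"
  unfolding avoids_def subseq_Cons_right by auto

lemma avoids_Nil: "p \<noteq> [] \<Longrightarrow> avoids [] p"
  by (auto simp: avoids_def order_isomorphic_def)

lemma order_isomorphic_213: "order_isomorphic (v # ys) [2, 1, 3] \<longleftrightarrow> (\<exists>a b. ys = [a, b] \<and> a < v \<and> v < b)"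
proof -
  have "order_isomorphic (v # ys) [2, 1, 3] \<Longrightarrow> \<exists>a b. ys = [a, b]"
    by (auto simp: order_isomorphic_def numeral_eq_Suc length_Suc_conv)
  moreover have "order_isomorphic [v, a, b] [2, 1, 3] \<longleftrightarrow> a < v \<and> v < b" for a b
    by (auto simp: order_isomorphic_def numeral_eq_Suc All_less_Suc2)
  ultimately show ?thesis by auto
qed

lemma order_isomorphic_132: "order_isomorphic (v # ys) [1, 3, 2] \<longleftrightarrow> (\<exists>a b. ys = [a, b] \<and> v < b \<and> b < a)"
proof -
  have "order_isomorphic (v # ys) [1, 3, 2] \<Longrightarrow> \<exists>a b. ys = [a, b]"
    by (auto simp: order_isomorphic_def numeral_eq_Suc length_Suc_conv)
  moreover have "order_isomorphic [v, a, b] [1, 3, 2] \<longleftrightarrow> v < b \<and> b < a" for a b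
    by (auto simp: order_isomorphic_def numeral_eq_Suc All_less_Suc2)
  ultimately show ?thesis by auto
qed

lemma order_isomorphic_1324:
  "order_isomorphic (v # ys) [1, 3, 2, 4] \<longleftrightarrow> (\<exists>c b d. ys = [c, b, d] \<and> v < b \<and> b < c \<and> c < d)"
proof -
  have "order_isomorphic (v # ys) [1, 3, 2, 4] \<Longrightarrow> \<exists>c b d. ys = [c, b, d]"
    by (auto simp: order_isomorphic_def numeral_eq_Suc length_Suc_conv)
  moreover have "order_isomorphic [v, c, b, d] [1, 3, 2, 4] \<longleftrightarrow> v < b \<and> b < c \<and> c < d" for b c d
    by (auto simp: order_isomorphic_def numeral_eq_Suc All_less_Suc2)
  ultimately show ?thesis by auto
qed

text \<open>A pattern 1324 that begins in the bottom cell contains a forbidden pattern of one cell unless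
  exactly its entries 1 and 2 lie in the bottom cell: if 3 also lies there, then 132 is a pattern of
  the bottom cell, and if 2 lies in the top cell, then 324 is a pattern 213 of the top cell. One that
  begins in the top cell lies there entirely and contains the pattern 213 as well. This is why only
  the mixed case occurs in the definition of \<open>bottom_site\<close>.\<close>

lemma admissible_iff_avoids:
  assumes "distinct s"
  shows "admissible r s \<longleftrightarrow> avoids s [1, 3, 2, 4] \<and> avoids (filter (\<lambda>v. r \<le> v) s) [2, 1, 3] \<and>
    avoids (filter (\<lambda>v. v < r) s) [1, 3, 2]"
  using assms
proof (induction s)
  case Nil thus ?case by (simp add: avoids_Nil)
next
  case (Cons v s)
  let ?A = "avoids s [1, 3, 2, 4]" and ?T = "avoids (filter (\<lambda>v. r \<le> v) s) [2, 1, 3]"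
    and ?B = "avoids (filter (\<lambda>v. v < r) s) [1, 3, 2]"
  have IH: "admissible r s \<longleftrightarrow> ?A \<and> ?T \<and> ?B" using Cons by simp
  have mem: "x \<in> set s" if "subseq xs s" "x \<in> set xs" for x xs
    using that by (rule subseq_setD)
  have vs: "v \<notin> set s" using Cons by simp
  have A: "avoids (v # s) [1, 3, 2, 4] \<longleftrightarrow> ?A \<and>
      \<not> (\<exists>c b d. subseq [c, b, d] s \<and> v < b \<and> b < c \<and> c < d)"
    unfolding avoids_Cons order_isomorphic_1324 by blast
  have top213: False if "?T" "subseq [c, b, d] s" "r \<le> b" "b < c" "c < d" for c b d
  proof -
    have "subseq [c, b, d] (filter (\<lambda>v. r \<le> v) s)" using that by (simp add: subseq_filter_iff)
    moreover have "order_isomorphic [c, b, d] [2, 1, 3]"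
      unfolding order_isomorphic_213 using that by blast
    ultimately show False using that(1) unfolding avoids_def by blast
  qed
  show ?case
  proof (cases "r \<le> v")
    case True
    have "avoids (filter (\<lambda>v. r \<le> v) (v # s)) [2, 1, 3] \<longleftrightarrow> ?T \<and>
        \<not> (\<exists>a b. subseq [a, b] (filter (\<lambda>v. r \<le> v) s) \<and> a < v \<and> v < b)"
      unfolding filter.simps(2) if_P[OF True] avoids_Cons order_isomorphic_213 by blast
    also have "(\<exists>a b. subseq [a, b] (filter (\<lambda>v. r \<le> v) s) \<and> a < v \<and> v < b)
        \<longleftrightarrow> \<not> top_site r s v"
    proof -
      have "b \<noteq> v" if "subseq [a, b] s" for a b using mem[OF that, of b] vs by auto
      hence "subseq [a, b] s \<and> (\<forall>x\<in>set [a, b]. r \<le> x) \<and> a < v \<and> v < b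
          \<longleftrightarrow> subseq [a, b] s \<and> r \<le> a \<and> a < v \<and> v \<le> b" for a b
        using True by (auto simp: order.order_iff_strict)
      thus ?thesis unfolding top_site_def subseq_filter_iff by (metis (no_types, lifting))
    qed
    finally have T: "avoids (filter (\<lambda>v. r \<le> v) (v # s)) [2, 1, 3] \<longleftrightarrow> ?T \<and> top_site r s v" by simp
    have B: "filter (\<lambda>v. v < r) (v # s) = filter (\<lambda>v. v < r) s" using True by simp
    have "\<not> (\<exists>c b d. subseq [c, b, d] s \<and> v < b \<and> b < c \<and> c < d)" if "?T"
    proof (intro notI, elim exE conjE)
      fix c b d assume "subseq [c, b, d] s" "v < b" "b < c" "c < d"
      thus False using top213[OF that, of c b d] True by linarith
    qed
    thus ?thesis unfolding admissible.simps if_P[OF True] T B A IH by blast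
  next
    case False
    hence lt: "v < r" by simp
    have "avoids (filter (\<lambda>v. v < r) (v # s)) [1, 3, 2] \<longleftrightarrow> ?B \<and>
        \<not> (\<exists>a b. subseq [a, b] (filter (\<lambda>v. v < r) s) \<and> v < b \<and> b < a)"
      unfolding filter.simps(2) if_P[OF lt] avoids_Cons order_isomorphic_132 by blast
    moreover have "(\<not> (\<exists>c b d. subseq [c, b, d] s \<and> v < b \<and> b < c \<and> c < d) \<and>
        \<not> (\<exists>a b. subseq [a, b] (filter (\<lambda>v. v < r) s) \<and> v < b \<and> b < a)) \<longleftrightarrow> bottom_site r s v"
      if "?T"
    proof
      assume L: "\<not> (\<exists>c b d. subseq [c, b, d] s \<and> v < b \<and> b < c \<and> c < d) \<and>
        \<not> (\<exists>a b. subseq [a, b] (filter (\<lambda>v. v < r) s) \<and> v < b \<and> b < a)"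
      show "bottom_site r s v"
        unfolding bottom_site_def
      proof (intro conjI notI; elim exE conjE)
        fix a b assume ab: "subseq [a, b] s" "a < r" "b < a" "v \<le> b"
        hence "b \<noteq> v" using mem[of "[a, b]" b] vs by auto
        hence "v < b" using ab by simp
        moreover have "subseq [a, b] (filter (\<lambda>v. v < r) s)"
          using ab by (simp add: subseq_filter_iff)
        ultimately show False using ab L by blast
      next
        fix c b d assume cbd: "subseq [c, b, d] s" "r \<le> c" "c < d" "b < r" "v \<le> b"
        hence "b \<noteq> v" using mem[of "[c, b, d]" b] vs by auto
        hence "v < b" "b < c" using cbd by auto
        thus False using cbd L by blast
      qed
    next
      assume R: "bottom_site r s v"
      show "\<not> (\<exists>c b d. subseq [c, b, d] s \<and> v < b \<and> b < c \<and> c < d) \<and>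
        \<not> (\<exists>a b. subseq [a, b] (filter (\<lambda>v. v < r) s) \<and> v < b \<and> b < a)"
      proof (intro conjI notI; elim exE conjE)
        fix c b d assume cbd: "subseq [c, b, d] s" "v < b" "b < c" "c < d"
        consider "r \<le> b" | "b < r" "r \<le> c" | "c < r" by linarith
        thus False
        proof cases
          case 1 thus False using top213[OF that] cbd by blast
        next
          case 2
          have "v \<le> b" "c < d" using cbd by simp_all
          thus False using R 2 cbd(1) unfolding bottom_site_def by blast
        next
          case 3
          have "subseq [c, b] s" by (rule subseq_order.trans[OF _ cbd(1)]) simp
          moreover have "v \<le> b" using cbd by simp
          ultimately show False using R 3 cbd(3) unfolding bottom_site_def by blast
        qed
      next
        fix a b assume "subseq [a, b] (filter (\<lambda>v. v < r) s)" "v < b" "b < a"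
        hence "subseq [a, b] s" "a < r" "b < a" "v \<le> b" by (simp_all add: subseq_filter_iff)
        thus False using R unfolding bottom_site_def by blast
      qed
    qed
    moreover have T: "filter (\<lambda>v. r \<le> v) (v # s) = filter (\<lambda>v. r \<le> v) s" using False by simp
    ultimately show ?thesis unfolding admissible.simps if_not_P[OF False] A IH T by blast
  qed
qed

lemma dominoes_altdef:
  "dominoes n = {(s, r). s \<in> permutations_of_set {1..n} \<and> r \<in> {1..Suc n} \<and> admissible r s}"
  by (auto simp: dominoes_def top_cell_def bottom_cell_def admissible_iff_avoids permutations_of_setD)

text \<open>Inserting the value \<open>v\<close> into a permutation shifts the values from \<open>v\<close> upwards.\<close>

definition bump :: "nat \<Rightarrow> nat \<Rightarrow> nat" where
  "bump v y = (if v \<le> y then Suc y else y)"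

definition unbump :: "nat \<Rightarrow> nat \<Rightarrow> nat" where
  "unbump v y = (if v < y then y - 1 else y)"

lemma strict_mono_bump: "strict_mono (bump v)"
  by (rule strict_monoI) (auto simp: bump_def)

lemma sites_map:
  assumes f: "strict_mono f" and r: "\<And>y. r' \<le> f y \<longleftrightarrow> r \<le> y"
  shows "top_site r' (map f s) (f v) \<longleftrightarrow> top_site r s v"
    and "bottom_site r' (map f s) (f v) \<longleftrightarrow> bottom_site r s v"
proof -
  have f': "f a < f b \<longleftrightarrow> a < b" "f a \<le> f b \<longleftrightarrow> a \<le> b" for a b
    using f by (auto simp: strict_mono_less strict_mono_less_eq)
  have r': "f y < r' \<longleftrightarrow> y < r" for y using r[of y] by linarith
  show "top_site r' (map f s) (f v) \<longleftrightarrow> top_site r s v"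
    unfolding top_site_def by (subst ex_subseq_map_pair) (simp add: f' r r')
  show "bottom_site r' (map f s) (f v) \<longleftrightarrow> bottom_site r s v"
    unfolding bottom_site_def by (subst ex_subseq_map_pair, subst ex_subseq_map_triple) (simp add: f' r r')
qed

lemma admissible_map:
  assumes f: "strict_mono f" and r: "\<And>y. r' \<le> f y \<longleftrightarrow> r \<le> y"
  shows "admissible r' (map f s) \<longleftrightarrow> admissible r s"
  by (induction s) (simp_all add: sites_map[OF f r] r)

lemma top_site_bump: "top_site r (map (bump v) s) v \<longleftrightarrow> top_site r s v" if "r \<le> v"
proof -
  have "r \<le> bump v a \<and> bump v a < v \<and> v \<le> bump v b \<longleftrightarrow> r \<le> a \<and> a < v \<and> v \<le> b" for a b
    using that by (auto simp: bump_def)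
  thus ?thesis unfolding top_site_def by (subst ex_subseq_map_pair) simp
qed

lemma bottom_site_bump: "bottom_site (Suc r) (map (bump v) s) v \<longleftrightarrow> bottom_site r s v" if "v \<le> r"
proof -
  have "bump v a < Suc r \<and> bump v b < bump v a \<and> v \<le> bump v b \<longleftrightarrow> a < r \<and> b < a \<and> v \<le> b" for a b
    using that by (auto simp: bump_def)
  moreover have "Suc r \<le> bump v c \<and> bump v c < bump v d \<and> bump v b < Suc r \<and> v \<le> bump v b
      \<longleftrightarrow> r \<le> c \<and> c < d \<and> b < r \<and> v \<le> b" for b c d
    using that by (auto simp: bump_def)
  ultimately show ?thesis unfolding bottom_site_def by (subst ex_subseq_map_pair, subst ex_subseq_map_triple) simp
qed

lemma admissible_insert_top:
  assumes "r \<le> v"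
  shows "admissible r (v # map (bump v) s) \<longleftrightarrow> admissible r s \<and> top_site r s v"
proof -
  have "r \<le> bump v y \<longleftrightarrow> r \<le> y" for y using assms by (auto simp: bump_def)
  thus ?thesis using assms by (simp add: admissible_map[OF strict_mono_bump] top_site_bump)
qed

lemma admissible_insert_bottom:
  assumes "v \<le> r"
  shows "admissible (Suc r) (v # map (bump v) s) \<longleftrightarrow> admissible r s \<and> bottom_site r s v"
proof -
  have "Suc r \<le> bump v y \<longleftrightarrow> r \<le> y" for y using assms by (auto simp: bump_def)
  thus ?thesis using assms by (simp add: admissible_map[OF strict_mono_bump] bottom_site_bump)
qed

lemma insert_permutation:
  assumes "s \<in> permutations_of_set {1..n}" "v \<in> {1..Suc n}"
  shows "v # map (bump v) s \<in> permutations_of_set {1..Suc n}"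
proof -
  have s: "set s = {1..n}" "distinct s" using assms by (auto simp: permutations_of_set_def)
  have "inj (bump v)" using strict_mono_bump by (rule strict_mono_imp_inj_on)
  hence "distinct (map (bump v) s)" using s by (auto simp: distinct_map intro: inj_on_subset)
  moreover have "v \<notin> bump v ` {1..n}" by (auto simp: bump_def)
  moreover have "insert v (bump v ` {1..n}) = {1..Suc n}"
  proof (intro equalityI subsetI)
    fix y assume y: "y \<in> {1..Suc n}"
    show "y \<in> insert v (bump v ` {1..n})"
    proof (cases "y = v")
      case False
      hence "y = bump v (unbump v y)" "unbump v y \<in> {1..n}"
        using y assms by (auto simp: bump_def unbump_def)
      thus ?thesis by blast
    qed auto
  qed (use assms in \<open>auto simp: bump_def split: if_splits\<close>)
  ultimately show ?thesis using s by (simp add: permutations_of_set_def)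
qed

lemma remove_permutation:
  assumes "v # s \<in> permutations_of_set {1..Suc n}"
  shows "map (unbump v) s \<in> permutations_of_set {1..n}" "map (bump v) (map (unbump v) s) = s" "v \<in> {1..Suc n}"
proof -
  have s: "insert v (set s) = {1..Suc n}" "distinct s" "v \<notin> set s"
    using assms by (auto simp: permutations_of_set_def)
  show v: "v \<in> {1..Suc n}" using s by blast
  have set_s: "set s = {1..Suc n} - {v}" using s by blast
  have bu: "bump v (unbump v y) = y" if "y \<in> set s" for y
    using that s by (auto simp: bump_def unbump_def)
  thus "map (bump v) (map (unbump v) s) = s" by (simp add: map_idI)
  have "inj_on (unbump v) (set s)" using bu by (metis inj_onI)
  moreover have "unbump v ` set s = {1..n}"
  proof (intro equalityI subsetI)
    fix y assume "y \<in> {1..n}"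
    hence "y = unbump v (bump v y)" "bump v y \<in> set s"
      unfolding set_s by (auto simp: bump_def unbump_def)
    thus "y \<in> unbump v ` set s" by blast
  qed (use v in \<open>auto simp: set_s unbump_def split: if_splits\<close>)
  ultimately show "map (unbump v) s \<in> permutations_of_set {1..n}"
    using s by (simp add: permutations_of_set_def distinct_map)
qed

lemma unbump_bump: "map (unbump v) (map (bump v) s) = s"
  by (rule map_idI[of s, THEN trans[rotated]]) (auto simp: bump_def unbump_def)

text \<open>A domino with \<open>n + 1\<close> points is the same as a domino with \<open>n\<close> points together with a cell and an
  admissible height for the new leftmost point.\<close>

lemma sum_dominoes_Suc:
  fixes f :: "nat list \<times> nat \<Rightarrow> real"
  shows "sum f (dominoes (Suc n)) = (\<Sum>(s, r)\<in>dominoes n.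
     (\<Sum>v | v \<in> {r..Suc n} \<and> top_site r s v. f (v # map (bump v) s, r)) +
     (\<Sum>v | v \<in> {1..r} \<and> bottom_site r s v. f (v # map (bump v) s, Suc r)))"
proof -
  let ?T = "{d \<in> dominoes (Suc n). snd d \<le> hd (fst d)}"
  let ?B = "{d \<in> dominoes (Suc n). \<not> snd d \<le> hd (fst d)}"
  have ne: "s \<noteq> []" if "(s, r) \<in> dominoes (Suc n)" for s r
  proof -
    have "s \<in> permutations_of_set {1..Suc n}" using that unfolding dominoes_altdef by blast
    hence "set s = {1..Suc n}" by (rule permutations_of_setD)
    thus ?thesis by auto
  qed
  have "dominoes (Suc n) = ?T \<union> ?B" by blast
  hence "sum f (dominoes (Suc n)) = sum f (?T \<union> ?B)" by (rule arg_cong)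
  also have "\<dots> = sum f ?T + sum f ?B"
    by (rule sum.union_disjoint) (auto simp: finite_dominoes)
  also have "sum f ?T = (\<Sum>((s, r), v)\<in>Sigma (dominoes n) (\<lambda>(s, r). {v. v \<in> {r..Suc n} \<and> top_site r s v}).
      f (v # map (bump v) s, r))"
  proof (rule sum.reindex_bij_witness[where i = "\<lambda>((s, r), v). (v # map (bump v) s, r)"
        and j = "\<lambda>(s, r). ((map (unbump (hd s)) (tl s), r), hd s)"])
    fix d assume "d \<in> ?T"
    moreover obtain s' r where "d = (s', r)" by (cases d)
    moreover from calculation ne obtain v s where "s' = v # s" by (cases s') auto
    ultimately have d: "d = (v # s, r)" "(v # s, r) \<in> dominoes (Suc n)" "r \<le> v" by auto
    note rm = remove_permutation[of v s n]
    have p: "v # s \<in> permutations_of_set {1..Suc n}" using d by (simp add: dominoes_altdef)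
    show 1: "(\<lambda>((s, r), v). (v # map (bump v) s, r)) ((\<lambda>(s, r). ((map (unbump (hd s)) (tl s), r), hd s)) d) = d"
      using d rm[OF p] by simp
    have "admissible r (v # map (bump v) (map (unbump v) s))" using d rm(2)[OF p] by (simp add: dominoes_altdef)
    hence "admissible r (map (unbump v) s)" "top_site r (map (unbump v) s) v"
      using admissible_insert_top[OF d(3)] by blast+
    moreover have "r \<in> {1..Suc n}" using d rm(3)[OF p] by (auto simp: dominoes_altdef)
    ultimately show "(\<lambda>(s, r). ((map (unbump (hd s)) (tl s), r), hd s)) d
        \<in> Sigma (dominoes n) (\<lambda>(s, r). {v. v \<in> {r..Suc n} \<and> top_site r s v})"
      using d rm[OF p] by (simp add: dominoes_altdef)
    show "(case (\<lambda>(s, r). ((map (unbump (hd s)) (tl s), r), hd s)) d of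
        (x, xa) \<Rightarrow> (case x of (s, r) \<Rightarrow> \<lambda>v. f (v # map (bump v) s, r)) xa) = f d"
      using d rm(2)[OF p] by simp
  next
    fix e assume "e \<in> Sigma (dominoes n) (\<lambda>(s, r). {v. v \<in> {r..Suc n} \<and> top_site r s v})"
    then obtain s r v where e: "e = ((s, r), v)" "(s, r) \<in> dominoes n" "v \<in> {r..Suc n}" "top_site r s v" by auto
    show "(\<lambda>(s, r). ((map (unbump (hd s)) (tl s), r), hd s)) ((\<lambda>((s, r), v). (v # map (bump v) s, r)) e) = e"
      using e unbump_bump[of v s] by simp
    have "v \<in> {1..Suc n}" using e by (auto simp: dominoes_altdef)
    thus "(\<lambda>((s, r), v). (v # map (bump v) s, r)) e \<in> ?T"
      using e insert_permutation[of s n v] admissible_insert_top[of r v s] by (auto simp: dominoes_altdef simp del: admissible.simps)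
  qed
  also have "sum f ?B = (\<Sum>((s, r), v)\<in>Sigma (dominoes n) (\<lambda>(s, r). {v. v \<in> {1..r} \<and> bottom_site r s v}).
      f (v # map (bump v) s, Suc r))"
  proof (rule sum.reindex_bij_witness[where i = "\<lambda>((s, r), v). (v # map (bump v) s, Suc r)"
        and j = "\<lambda>(s, r). ((map (unbump (hd s)) (tl s), r - 1), hd s)"])
    fix d assume "d \<in> ?B"
    moreover obtain s' r' where "d = (s', r')" by (cases d)
    moreover from calculation ne obtain v s where "s' = v # s" by (cases s') auto
    ultimately have d': "d = (v # s, r')" "(v # s, r') \<in> dominoes (Suc n)" "v < r'" by auto
    then obtain r where "r' = Suc r" by (cases r') auto
    with d' have d: "d = (v # s, Suc r)" "(v # s, Suc r) \<in> dominoes (Suc n)" "v \<le> r" by auto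
    note rm = remove_permutation[of v s n]
    have p: "v # s \<in> permutations_of_set {1..Suc n}" using d by (simp add: dominoes_altdef)
    show 1: "(\<lambda>((s, r), v). (v # map (bump v) s, Suc r)) ((\<lambda>(s, r). ((map (unbump (hd s)) (tl s), r - 1), hd s)) d) = d"
      using d rm[OF p] by simp
    have "admissible (Suc r) (v # map (bump v) (map (unbump v) s))" using d rm(2)[OF p] by (simp add: dominoes_altdef)
    hence "admissible r (map (unbump v) s)" "bottom_site r (map (unbump v) s) v"
      using admissible_insert_bottom[OF d(3)] by blast+
    moreover have "r \<in> {1..Suc n}" using d rm(3)[OF p] by (auto simp: dominoes_altdef)
    ultimately show "(\<lambda>(s, r). ((map (unbump (hd s)) (tl s), r - 1), hd s)) d
        \<in> Sigma (dominoes n) (\<lambda>(s, r). {v. v \<in> {1..r} \<and> bottom_site r s v})"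
      using d rm[OF p] by (simp add: dominoes_altdef)
    show "(case (\<lambda>(s, r). ((map (unbump (hd s)) (tl s), r - 1), hd s)) d of
        (x, xa) \<Rightarrow> (case x of (s, r) \<Rightarrow> \<lambda>v. f (v # map (bump v) s, Suc r)) xa) = f d"
      using d rm(2)[OF p] by simp
  next
    fix e assume "e \<in> Sigma (dominoes n) (\<lambda>(s, r). {v. v \<in> {1..r} \<and> bottom_site r s v})"
    then obtain s r v where e: "e = ((s, r), v)" "(s, r) \<in> dominoes n" "v \<in> {1..r}" "bottom_site r s v" by auto
    show "(\<lambda>(s, r). ((map (unbump (hd s)) (tl s), r - 1), hd s)) ((\<lambda>((s, r), v). (v # map (bump v) s, Suc r)) e) = e"
      using e unbump_bump[of v s] by simp
    have "v \<in> {1..Suc n}" using e by (auto simp: dominoes_altdef)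
    thus "(\<lambda>((s, r), v). (v # map (bump v) s, Suc r)) e \<in> ?B"
      using e insert_permutation[of s n v] admissible_insert_bottom[of v r s] by (auto simp: dominoes_altdef simp del: admissible.simps)
  qed
  finally have "sum f (dominoes (Suc n)) =
     (\<Sum>((s, r), v)\<in>Sigma (dominoes n) (\<lambda>(s, r). {v. v \<in> {r..Suc n} \<and> top_site r s v}). f (v # map (bump v) s, r)) +
     (\<Sum>((s, r), v)\<in>Sigma (dominoes n) (\<lambda>(s, r). {v. v \<in> {1..r} \<and> bottom_site r s v}). f (v # map (bump v) s, Suc r))" .
  moreover have "(\<Sum>((s, r), v)\<in>Sigma (dominoes n) (\<lambda>(s, r). F s r). g s r v)
      = (\<Sum>(s, r)\<in>dominoes n. \<Sum>v\<in>F s r. g s r v)"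
    if "\<And>s r. finite (F s r)" for F and g :: "nat list \<Rightarrow> nat \<Rightarrow> nat \<Rightarrow> real"
    using sum.Sigma[of "dominoes n" "\<lambda>(s, r). F s r" "\<lambda>(s, r) v. g s r v"] that
    by (simp add: finite_dominoes case_prod_unfold)
  moreover have "finite {v. v \<in> {a..b} \<and> P v}" for a b :: nat and P
    by (rule finite_subset[of _ "{a..b}"]) auto
  ultimately have "sum f (dominoes (Suc n)) =
     (\<Sum>(s, r)\<in>dominoes n. \<Sum>v | v \<in> {r..Suc n} \<and> top_site r s v. f (v # map (bump v) s, r)) +
     (\<Sum>(s, r)\<in>dominoes n. \<Sum>v | v \<in> {1..r} \<and> bottom_site r s v. f (v # map (bump v) s, Suc r))"
    by (simp only:)
  thus ?thesis by (simp only: sum.distrib[symmetric] split_def)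
qed

section \<open>Live insertion sites\<close>

text \<open>The part of \<open>l\<close> behind its last entry of size at least \<open>v\<close>.\<close>

definition chop :: "nat \<Rightarrow> nat list \<Rightarrow> nat list" where
  "chop v l = rev (takeWhile (\<lambda>y. y < v) (rev l))"

text \<open>The points \<open>y\<close> such that the next point can be inserted directly below \<open>y\<close> in the same cell.
  A site of the top cell is attached to the place of the rightmost point that is at least as high as \<open>y\<close>, and a site of the bottom cell to the place of \<open>y\<close>;
  the list is ordered by these places from left to right. A new top point destroys all sites up
  to the rightmost point above it, a new bottom point those sites of its own cell that are lower.\<close>

fun live_sites :: "nat \<Rightarrow> nat list \<Rightarrow> nat list" where
  "live_sites r [] = []"
| "live_sites r (v # s) = v # (if r \<le> v then chop v (live_sites r s) else filter (\<lambda>y. v < y) (live_sites r s))"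

lemma chop_append: "v \<le> t \<Longrightarrow> (\<And>x. x \<in> set q \<Longrightarrow> x < v) \<Longrightarrow> chop v (p @ t # q) = q"
  by (simp add: chop_def takeWhile_append)

lemma chop_all: "(\<And>x. x \<in> set q \<Longrightarrow> x < v) \<Longrightarrow> chop v q = q"
proof -
  assume "\<And>x. x \<in> set q \<Longrightarrow> x < v"
  hence "takeWhile (\<lambda>y. y < v) (rev q) = rev q"
    by (intro takeWhile_eq_all_conv[THEN iffD2]) auto
  thus ?thesis unfolding chop_def by (simp only: rev_rev_ident)
qed

lemma chop_split: obtains p where "l = p @ chop v l" "p = [] \<or> v \<le> last p"
proof
  define p where "p = rev (dropWhile (\<lambda>y. y < v) (rev l))"
  have "rev l = takeWhile (\<lambda>y. y < v) (rev l) @ dropWhile (\<lambda>y. y < v) (rev l)" by simp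
  thus "l = p @ chop v l" unfolding p_def chop_def by (metis rev_append rev_rev_ident)
  show "p = [] \<or> v \<le> last p"
  proof (cases "dropWhile (\<lambda>y. y < v) (rev l) = []")
    case False
    thus ?thesis using hd_dropWhile[OF False] by (simp add: p_def last_rev not_less del: dropWhile_eq_Nil_conv)
  qed (simp only: p_def rev.simps simp_thms)
qed

lemma set_chop_less: "x \<in> set (chop v l) \<Longrightarrow> x < v"
  by (auto simp: chop_def dest: set_takeWhileD)

text \<open>How the list of live sites records the horizontal order: sites of the top cell descend, sites of
  the bottom cell ascend, and a site of the bottom cell precedes a site \<open>b\<close> of the top cell exactly if
  some point of height at least \<open>b\<close> lies to the right of it.\<close>

definition live_order :: "nat \<Rightarrow> nat list \<Rightarrow> nat \<Rightarrow> nat \<Rightarrow> bool" where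
  "live_order r s a b \<longleftrightarrow>
     (r \<le> a \<and> r \<le> b \<longrightarrow> b < a) \<and> (a < r \<and> b < r \<longrightarrow> a < b) \<and>
     (a < r \<and> r \<le> b \<longrightarrow> (\<exists>d\<ge>b. subseq [a, d] s)) \<and>
     (r \<le> a \<and> b < r \<longrightarrow> \<not> (\<exists>d\<ge>a. subseq [b, d] s))"

lemma subseq_pair_trans:
  assumes "distinct s" "subseq [a, b] s" "subseq [b, c] s"
  shows "subseq [a, c] s"
  using assms
proof (induction s)
  case (Cons x s)
  have "subseq [a, b] s \<Longrightarrow> b \<in> set s" "subseq [b, c] s \<Longrightarrow> b \<in> set s \<and> c \<in> set s"
    by (auto dest: subseq_setD)
  thus ?case using Cons by (auto simp: subseq_Cons_right subseq_singleton_left)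
qed auto

lemma subseq_pair_total:
  assumes "a \<in> set s" "b \<in> set s" "a \<noteq> b"
  shows "subseq [a, b] s \<or> subseq [b, a] s"
  using assms by (induction s) (auto simp: subseq_Cons_right subseq_singleton_left)

lemma set_live_sites_subset: "set (live_sites r s) \<subseteq> set s"
proof -
  have sub: "set (chop v l) \<subseteq> set l" for v l by (auto simp: chop_def dest!: set_takeWhileD)
  show ?thesis by (induction s) (auto dest: subsetD[OF sub])
qed

text \<open>Both statements are proved together by induction on the domino. The delicate case is a new top
  point \<open>v\<close>. A site \<open>e\<close> of the bottom cell becomes inadmissible exactly if some bottom point of height at
  least \<open>e\<close> has a top point higher than \<open>v\<close> to its right. The lowest top point \<open>t\<close> above \<open>v\<close> is live, as
  otherwise \<open>v\<close> itself would not be admissible, and by the second statement the condition says that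
  \<open>e\<close> precedes \<open>t\<close> in the list. So \<open>chop\<close> removes just the right sites.\<close>

lemma live_invariant:
  assumes "distinct s" "admissible r s"
  shows "set (live_sites r s) = {e \<in> set s. if r \<le> e then top_site r s e else bottom_site r s e}"
    and "sorted_wrt (live_order r s) (live_sites r s)"
proof -
  have "set (live_sites r s) = {e \<in> set s. if r \<le> e then top_site r s e else bottom_site r s e} \<and>
    sorted_wrt (live_order r s) (live_sites r s)"
    using assms
  proof (induction s)
    case Nil thus ?case by simp
  next
    case (Cons v s)
    define l where "l = live_sites r s"
    have ds: "distinct s" and vs: "v \<notin> set s" and gs: "admissible r s" using Cons.prems by auto
    have IH1: "e \<in> set l \<longleftrightarrow> e \<in> set s \<and> (if r \<le> e then top_site r s e else bottom_site r s e)" for e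
      using Cons.IH[OF ds gs] unfolding l_def by blast
    have IH2: "sorted_wrt (live_order r s) l" using Cons.IH[OF ds gs] unfolding l_def by blast
    have mem: "x \<in> set s" if "subseq xs s" "x \<in> set xs" for x xs
      using that by (rule subseq_setD)
    have rel_Cons: "live_order r (v # s) a b \<longleftrightarrow> live_order r s a b" if "a \<noteq> v" "b \<noteq> v" for a b
      using that by (simp add: live_order_def subseq_Cons_right)
    have sw: "sorted_wrt (live_order r (v # s)) l"
      using IH2 vs IH1 by (intro sorted_wrt_mono_rel[OF _ IH2]) (metis rel_Cons)
    have top_e: "top_site r (v # s) e \<longleftrightarrow> top_site r s e \<and> (r \<le> v \<longrightarrow> e < v)" if "e \<in> set s" for e
    proof -
      have "e \<noteq> v" using that vs by auto
      have "(\<exists>a b. subseq [a, b] (v # s) \<and> r \<le> a \<and> a < e \<and> e \<le> b) \<longleftrightarrow>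
         (\<exists>a b. subseq [a, b] s \<and> r \<le> a \<and> a < e \<and> e \<le> b) \<or> (r \<le> v \<and> v < e \<and> (\<exists>b\<in>set s. e \<le> b))"
        by (auto simp: subseq_Cons_right subseq_singleton_left)
      thus ?thesis unfolding top_site_def using that \<open>e \<noteq> v\<close> by (auto simp: not_less)
    qed
    have bottom_e: "bottom_site r (v # s) e \<longleftrightarrow> bottom_site r s e \<and>
        (if r \<le> v then \<not> (\<exists>b d. subseq [b, d] s \<and> v < d \<and> b < r \<and> e \<le> b) else v < e)"
      if "e \<in> set s" for e
    proof -
      have "e \<noteq> v" using that vs by auto
      have "(\<exists>a b. subseq [a, b] (v # s) \<and> a < r \<and> b < a \<and> e \<le> b) \<longleftrightarrow>
         (\<exists>a b. subseq [a, b] s \<and> a < r \<and> b < a \<and> e \<le> b) \<or> (v < r \<and> (\<exists>b\<in>set s. b < v \<and> e \<le> b))"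
        by (auto simp: subseq_Cons_right subseq_singleton_left)
      moreover have "(\<exists>b\<in>set s. b < v \<and> e \<le> b) \<longleftrightarrow> e < v"
        using that by auto
      moreover have "(\<exists>c b d. subseq [c, b, d] (v # s) \<and> r \<le> c \<and> c < d \<and> b < r \<and> e \<le> b) \<longleftrightarrow>
         (\<exists>c b d. subseq [c, b, d] s \<and> r \<le> c \<and> c < d \<and> b < r \<and> e \<le> b) \<or>
         (r \<le> v \<and> (\<exists>b d. subseq [b, d] s \<and> v < d \<and> b < r \<and> e \<le> b))"
        by (auto simp: subseq_Cons_right)
      ultimately show ?thesis unfolding bottom_site_def using \<open>e \<noteq> v\<close> by (auto simp: not_less)
    qed
    have v_ok: "if r \<le> v then top_site r (v # s) v else bottom_site r (v # s) v"
    proof (cases "r \<le> v")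
      case True
      hence "top_site r s v" using Cons.prems by simp
      thus ?thesis using True unfolding top_site_def by (auto simp: subseq_Cons_right)
    next
      case False
      hence "bottom_site r s v" using Cons.prems by simp
      thus ?thesis using False unfolding bottom_site_def by (auto simp: subseq_Cons_right)
    qed
    show ?case
    proof (cases "r \<le> v")
      case False
      define l' where "l' = filter (\<lambda>y. v < y) l"
      have live_sites: "live_sites r (v # s) = v # l'" using False by (simp add: l'_def l_def)
      have l': "e \<in> set l' \<longleftrightarrow> e \<in> set s \<and> (if r \<le> e then top_site r (v # s) e else bottom_site r (v # s) e)" for e
        using False unfolding l'_def by (auto simp: IH1 top_e bottom_e)
      have "sorted_wrt (live_order r (v # s)) l'"
        unfolding l'_def using sw by (rule sorted_wrt_filter)
      moreover have "live_order r (v # s) v x" if "x \<in> set l'" for x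
      proof -
        have "v < x" "x \<in> set s" using that by (auto simp: l'_def IH1)
        thus ?thesis using False unfolding live_order_def
          by (auto simp: subseq_Cons_right subseq_singleton_left)
      qed
      ultimately have "sorted_wrt (live_order r (v # s)) (v # l')" by simp
      moreover have "e \<in> set (v # l') \<longleftrightarrow>
          e \<in> set (v # s) \<and> (if r \<le> e then top_site r (v # s) e else bottom_site r (v # s) e)" for e
        using l'[of e] v_ok by (cases "e = v") (simp_all only: list.set insert_iff simp_thms)
      ultimately show ?thesis unfolding live_sites by blast
    next
      case True
      define l' where "l' = chop v l"
      have live_sites: "live_sites r (v # s) = v # l'" using True by (simp add: l'_def l_def)
      obtain p where p: "l = p @ l'" "p = [] \<or> v \<le> last p"
        using chop_split[of l v] unfolding l'_def by blast
      have vl: "v \<notin> set l" using vs IH1 by blast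
      have v_site: "top_site r s v" using Cons.prems True by simp
      have before: "live_order r s a b" if "a \<in> set p" "b \<in> set l'" for a b
        using IH2 that unfolding p(1) by (auto simp: sorted_wrt_append)
      have l': "e \<in> set l' \<longleftrightarrow> e \<in> set s \<and> (if r \<le> e then top_site r (v # s) e else bottom_site r (v # s) e)" for e
      proof
        assume e: "e \<in> set l'"
        hence el: "e \<in> set l" using p by auto
        have ev: "e < v" using e unfolding l'_def by (rule set_chop_less)
        have es: "e \<in> set s" using el IH1 by blast
        show "e \<in> set s \<and> (if r \<le> e then top_site r (v # s) e else bottom_site r (v # s) e)"
        proof (cases "r \<le> e")
          case re: True
          thus ?thesis using el ev es IH1[of e] top_e[OF es] by auto
        next
          case re: False
          have be: "bottom_site r s e" using el re IH1[of e] by auto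
          have "\<not> (\<exists>b d. subseq [b, d] s \<and> v < d \<and> b < r \<and> e \<le> b)"
          proof
            assume "\<exists>b d. subseq [b, d] s \<and> v < d \<and> b < r \<and> e \<le> b"
            then obtain b d where bd: "subseq [b, d] s" "v < d" "b < r" "e \<le> b" by blast
            have ed: "subseq [e, d] s"
            proof (cases "b = e")
              case False
              have "b \<in> set s" using mem[OF bd(1)] by simp
              hence "subseq [e, b] s \<or> subseq [b, e] s"
                using es False by (intro subseq_pair_total) auto
              moreover have "\<not> subseq [b, e] s"
              proof
                assume "subseq [b, e] s"
                moreover have "e < b" "e \<le> e" using bd False by simp_all
                ultimately show False using be bd(3) unfolding bottom_site_def by blast
              qed
              ultimately show ?thesis using subseq_pair_trans[OF ds _ bd(1)] by blast
            qed (use bd in auto)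
            \<comment> \<open>The lowest point above \<open>v\<close> is a live site, and it lies before the part of the
              list that \<open>chop\<close> keeps.\<close>
            define t where "t = Min {x \<in> set s. v < x}"
            have fin: "finite {x \<in> set s. v < x}" by simp
            have d_in: "d \<in> {x \<in> set s. v < x}" using mem[OF bd(1)] bd by auto
            have t: "t \<in> set s" "v < t" "t \<le> d"
              using Min_in[OF fin] Min_le[OF fin d_in] d_in unfolding t_def by blast+
            have t_min: "t \<le> x" if "x \<in> set s" "v < x" for x
              unfolding t_def using that by (intro Min_le) auto
            have "top_site r s t"
              unfolding top_site_def
            proof (intro notI, elim exE conjE)
              fix a b assume ab: "subseq [a, b] s" "r \<le> a" "a < t" "t \<le> b"
              have "a \<in> set s" using mem[OF ab(1)] by simp
              hence "a < v" using t_min[of a] ab vs by (metis linorder_neqE_nat not_le)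
              moreover have "v \<le> b" using ab t by linarith
              ultimately show False using v_site ab unfolding top_site_def by blast
            qed
            hence "t \<in> set l" using t True by (simp add: IH1)
            moreover have "t \<notin> set l'" using set_chop_less[of t v l] t unfolding l'_def by auto
            ultimately have "t \<in> set p" using p(1) by auto
            hence "live_order r s t e" using before e by blast
            thus False using ed t re True unfolding live_order_def by auto
          qed
          thus ?thesis using be es re bottom_e[OF es] True by auto
        qed
      next
        assume e: "e \<in> set s \<and> (if r \<le> e then top_site r (v # s) e else bottom_site r (v # s) e)"
        hence el: "e \<in> set l" using top_e[of e] bottom_e[of e] by (auto simp: IH1)
        show "e \<in> set l'"
        proof (rule ccontr)
          assume "e \<notin> set l'"
          hence ep: "e \<in> set p" using el p by auto
          \<comment> \<open>The last site removed lies above \<open>v\<close>, and \<open>e\<close> equals or precedes it.\<close>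
          define t where "t = last p"
          have pt: "p = butlast p @ [t]" using ep unfolding t_def by (metis append_butlast_last_id empty_iff list.set(1))
          have "p \<noteq> []" using ep by auto
          hence t: "v \<le> t" "t \<in> set p" using p(2) unfolding t_def by auto
          have tl: "t \<in> set l" using t p by auto
          hence tv: "v < t" using t vl by (metis le_neq_implies_less)
          have "t = e \<or> live_order r s e t"
          proof (cases "t = e")
            case False
            hence "e \<in> set (butlast p)" using ep pt by (metis Un_iff empty_iff list.set(1) set_ConsD set_append)
            moreover have "sorted_wrt (live_order r s) (butlast p @ [t])"
              using IH2 p(1) pt by (metis sorted_wrt_append)
            ultimately show ?thesis by (auto simp: sorted_wrt_append)
          qed auto
          thus False
          proof
            assume "t = e"
            thus False using e tv True top_e[of e] by auto
          next
            assume rel: "live_order r s e t"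
            show False
            proof (cases "r \<le> e")
              case re: True
              have "e < v" using e re True top_e[of e] by auto
              thus False using rel re tv True unfolding live_order_def by auto
            next
              case re: False
              then obtain d where "t \<le> d" "subseq [e, d] s"
                using rel tv True unfolding live_order_def by auto
              thus False using e re True tv bottom_e[of e] by (auto simp: not_le)
            qed
          qed
        qed
      qed
      have "sorted_wrt (live_order r (v # s)) l'"
        using sw unfolding p(1) by (simp add: sorted_wrt_append)
      moreover have "live_order r (v # s) v x" if x: "x \<in> set l'" for x
      proof -
        have xv: "x < v" using x unfolding l'_def by (rule set_chop_less)
        have xs: "x \<in> set s" using x l' by blast
        have "\<not> (\<exists>d\<ge>v. subseq [x, d] (v # s))" if "x < r"
        proof
          assume "\<exists>d\<ge>v. subseq [x, d] (v # s)"
          then obtain d where d: "d \<ge> v" "subseq [x, d] s" using xv by (auto simp: subseq_Cons_right)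
          have "d \<noteq> v" using mem[OF d(2)] vs by auto
          moreover have "bottom_site r (v # s) x" using x l'[of x] that by auto
          ultimately show False using d bottom_e[OF xs] True that by auto
        qed
        thus ?thesis using xv True unfolding live_order_def by auto
      qed
      ultimately have "sorted_wrt (live_order r (v # s)) (v # l')" by simp
      moreover have "e \<in> set (v # l') \<longleftrightarrow>
          e \<in> set (v # s) \<and> (if r \<le> e then top_site r (v # s) e else bottom_site r (v # s) e)" for e
        using l'[of e] v_ok by (cases "e = v") (simp_all only: list.set insert_iff simp_thms)
      ultimately show ?thesis unfolding live_sites by blast
    qed
  qed
  thus "set (live_sites r s) = {e \<in> set s. if r \<le> e then top_site r s e else bottom_site r s e}"
    and "sorted_wrt (live_order r s) (live_sites r s)" by auto
qed

section \<open>From dominoes to walks\<close>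

text \<open>Only the cells of the live sites matter for the further evolution.\<close>

definition state_word :: "nat \<Rightarrow> nat list \<Rightarrow> bool list" where
  "state_word r s = map (\<lambda>y. r \<le> y) (live_sites r s)"

fun num_top_leaves :: "nat \<Rightarrow> nat list \<Rightarrow> nat" where
  "num_top_leaves r [] = 0"
| "num_top_leaves r (v # s) = (if r \<le> v \<and> (\<forall>y\<in>set s. y \<le> v) then 1 else 0) + num_top_leaves r s"

lemma card_top_leaves: "card (top_leaves (s, r)) = num_top_leaves r s"
proof (induction s)
  case Nil thus ?case by (simp add: top_leaves_def)
next
  case (Cons v s)
  let ?Z = "if r \<le> v \<and> (\<forall>y\<in>set s. y \<le> v) then {0 :: nat} else {}"
  have fin: "finite (top_leaves (s, r))"
    unfolding top_leaves_def by (rule finite_subset[of _ "{..<length s}"]) auto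
  have "i \<in> top_leaves (v # s, r) \<longleftrightarrow> i \<in> ?Z \<union> Suc ` top_leaves (s, r)" for i
  proof (cases i)
    case 0
    have "(\<exists>j. 0 < j \<and> j < Suc (length s) \<and> (v # s) ! j > v) \<longleftrightarrow> (\<exists>j<length s. s ! j > v)"
    proof
      assume "\<exists>j. 0 < j \<and> j < Suc (length s) \<and> (v # s) ! j > v"
      then obtain j where "0 < j" "j < Suc (length s)" "(v # s) ! j > v" by blast
      thus "\<exists>j<length s. s ! j > v" by (cases j) auto
    qed force
    also have "\<dots> \<longleftrightarrow> \<not> (\<forall>y\<in>set s. y \<le> v)"
      unfolding all_set_conv_all_nth by (auto simp: not_le)
    finally show ?thesis using 0 by (auto simp: top_leaves_def)
  next
    case (Suc k)
    have "(\<exists>j. Suc k < j \<and> j < Suc (length s) \<and> (v # s) ! j > s ! k) \<longleftrightarrow>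
        (\<exists>j. k < j \<and> j < length s \<and> s ! j > s ! k)"
    proof
      assume "\<exists>j. Suc k < j \<and> j < Suc (length s) \<and> (v # s) ! j > s ! k"
      then obtain j where "Suc k < j" "j < Suc (length s)" "(v # s) ! j > s ! k" by blast
      thus "\<exists>j. k < j \<and> j < length s \<and> s ! j > s ! k" by (cases j) auto
    qed force
    thus ?thesis using Suc by (auto simp: top_leaves_def)
  qed
  hence "top_leaves (v # s, r) = ?Z \<union> Suc ` top_leaves (s, r)" by blast
  hence "card (top_leaves (v # s, r)) = card ?Z + card (Suc ` top_leaves (s, r))"
    using fin by (simp add: card_Un_disjoint)
  thus ?case using Cons by (simp add: card_image)
qed

lemma num_top_leaves_map:
  assumes f: "strict_mono f" and r: "\<And>y. r' \<le> f y \<longleftrightarrow> r \<le> y"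
  shows "num_top_leaves r' (map f s) = num_top_leaves r s"
  by (induction s) (simp_all add: r strict_mono_less_eq[OF f])

lemma live_sites_map:
  assumes f: "strict_mono f" and r: "\<And>y. r' \<le> f y \<longleftrightarrow> r \<le> y"
  shows "live_sites r' (map f s) = map f (live_sites r s)"
proof -
  have "chop (f v) (map f l) = map f (chop v l)" for v l
    unfolding chop_def by (simp add: rev_map takeWhile_map o_def strict_mono_less[OF f])
  thus ?thesis
    by (induction s) (simp_all add: r filter_map o_def strict_mono_less[OF f])
qed

lemma distinct_live_sites: "distinct s \<Longrightarrow> distinct (live_sites r s)"
proof (induction s)
  case (Cons v s)
  have "distinct (chop v l)" if "distinct l" for l
    using that by (simp add: chop_def)
  moreover have "v \<notin> set (chop v l)" for l using set_chop_less[of v v l] by auto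
  ultimately show ?case using Cons by auto
qed auto

lemma length_live_sites: "length (live_sites r s) \<le> length s"
proof (induction s)
  case (Cons v s)
  have "length (chop v l) \<le> length l" for l
    by (simp add: chop_def) (metis length_rev length_takeWhile_le)
  moreover have "length (filter (\<lambda>y. v < y) (live_sites r s)) \<le> length s"
    using length_filter_le Cons by (rule le_trans)
  ultimately show ?case using Cons by (auto intro: le_trans)
qed auto

text \<open>For a new top point at the live site \<open>v\<close>, the remaining list starts at \<open>v\<close>.\<close>

lemma sum_top_suffixes:
  fixes g :: "bool list \<Rightarrow> real" and l :: "nat list"
  assumes "distinct l"
  shows "(\<Sum>v | v \<in> set l \<and> r \<le> v. g (map (\<lambda>y. r \<le> y) (dropWhile (\<lambda>y. y \<noteq> v) l))) =
    sum_list (map g (top_suffixes (map (\<lambda>y. r \<le> y) l)))"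
  using assms
proof (induction l)
  case (Cons y l)
  let ?h = "\<lambda>l v. g (map (\<lambda>y. r \<le> y) (dropWhile (\<lambda>y. y \<noteq> v) l))"
  have tail: "(\<Sum>v | v \<in> set l \<and> r \<le> v. ?h (y # l) v) = (\<Sum>v | v \<in> set l \<and> r \<le> v. ?h l v)"
    using Cons.prems by (intro sum.cong) auto
  show ?case
  proof (cases "r \<le> y")
    case True
    hence "{v. v \<in> set (y # l) \<and> r \<le> v} = insert y {v. v \<in> set l \<and> r \<le> v}" by auto
    thus ?thesis using Cons True tail by simp
  next
    case False
    hence "{v. v \<in> set (y # l) \<and> r \<le> v} = {v. v \<in> set l \<and> r \<le> v}" by auto
    thus ?thesis using Cons False tail by simp
  qed
qed auto

text \<open>A new bottom point at the site \<open>v\<close> destroys the bottom sites below \<open>v\<close>, and these come first in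
  the list because the bottom sites ascend. The choice \<open>v = r\<close> is the height above the whole bottom
  cell and destroys all of them.\<close>

lemma sum_bottom_deletions:
  fixes g :: "bool list \<Rightarrow> real" and l :: "nat list"
  assumes "sorted_wrt (\<lambda>a b. a < r \<and> b < r \<longrightarrow> a < b) l"
  shows "(\<Sum>v\<in>insert r {v \<in> set l. v < r}. g (map (\<lambda>y. r \<le> y) (filter (\<lambda>y. v \<le> y) l))) =
    sum_list (map g (bottom_deletions (map (\<lambda>y. r \<le> y) l)))"
  using assms
proof (induction l arbitrary: g)
  case (Cons y l)
  let ?h = "\<lambda>g l v. g (map (\<lambda>y. r \<le> y) (filter (\<lambda>y. v \<le> y) l))"
  have sw: "sorted_wrt (\<lambda>a b. a < r \<and> b < r \<longrightarrow> a < b) l" using Cons.prems by simp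
  show ?case
  proof (cases "r \<le> y")
    case True
    hence "{v \<in> set (y # l). v < r} = {v \<in> set l. v < r}" by auto
    moreover have "(\<Sum>v\<in>insert r {v \<in> set l. v < r}. ?h g (y # l) v) =
        (\<Sum>v\<in>insert r {v \<in> set l. v < r}. ?h (\<lambda>w. g (True # w)) l v)"
      using True by (intro sum.cong) auto
    ultimately show ?thesis using Cons.IH[OF sw, of "\<lambda>w. g (True # w)"] True
      by (simp only:) (simp add: o_def)
  next
    case False
    have gt: "y < x" if "x \<in> set l" for x
      using Cons.prems that False by (cases "x < r") auto
    have "insert r {v \<in> set (y # l). v < r} = insert y (insert r {v \<in> set l. v < r})"
      using False by auto
    moreover have "y \<notin> insert r {v \<in> set l. v < r}" using gt False by auto
    ultimately have "(\<Sum>v\<in>insert r {v \<in> set (y # l). v < r}. ?h g (y # l) v) =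
        ?h g (y # l) y + (\<Sum>v\<in>insert r {v \<in> set l. v < r}. ?h g (y # l) v)"
      by (simp only: sum.insert finite.insertI finite_set finite_filter if_False simp_thms) simp
    also have "(\<Sum>v\<in>insert r {v \<in> set l. v < r}. ?h g (y # l) v) =
        (\<Sum>v\<in>insert r {v \<in> set l. v < r}. ?h g l v)"
    proof (intro sum.cong refl)
      fix v assume "v \<in> insert r {v \<in> set l. v < r}"
      hence "y < v" using gt False by auto
      thus "?h g (y # l) v = ?h g l v" by simp
    qed
    also have "?h g (y # l) y = g (False # map (\<lambda>y. r \<le> y) l)"
    proof -
      have "filter (\<lambda>x. y \<le> x) l = l" using gt by (auto simp: filter_id_conv intro: less_imp_le)
      thus ?thesis using False by simp
    qed
    finally show ?thesis using Cons.IH[OF sw, of g] False by simp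
  qed
qed auto

text \<open>The admissible heights in the top cell are the live sites and the new maximum \<open>n + 1\<close>, those in the
  bottom cell are the live sites and the boundary \<open>r\<close>. Only a new maximum is a new leaf. Points that
  are already present keep their status, since a new leftmost point lies to the right of none of them.\<close>

lemma sum_children:
  fixes x :: real and g :: "bool list \<Rightarrow> real"
  assumes "(s, r) \<in> dominoes n"
  shows "(\<Sum>v | v \<in> {r..Suc n} \<and> top_site r s v.
      x ^ num_top_leaves r (v # map (bump v) s) * g (state_word r (v # map (bump v) s))) =
      x ^ num_top_leaves r s * (x * g (True # state_word r s) + sum_list (map g (top_suffixes (state_word r s))))" (is ?top)
    and "(\<Sum>v | v \<in> {1..r} \<and> bottom_site r s v.
      x ^ num_top_leaves (Suc r) (v # map (bump v) s) * g (state_word (Suc r) (v # map (bump v) s))) =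
      x ^ num_top_leaves r s * sum_list (map (\<lambda>t. g (False # t)) (bottom_deletions (state_word r s)))" (is ?bottom)
proof -
  have p: "s \<in> permutations_of_set {1..n}" and r: "1 \<le> r" "r \<le> Suc n" and admissible: "admissible r s"
    using assms by (auto simp: dominoes_altdef)
  have set_s: "set s = {1..n}" and ds: "distinct s" using p by (auto dest: permutations_of_setD)
  define l where "l = live_sites r s"
  note inv = live_invariant[OF ds admissible, folded l_def]
  have dl: "distinct l" unfolding l_def using ds by (rule distinct_live_sites)
  have sub: "y \<in> {1..n}" if "y \<in> set l" for y
    using that set_live_sites_subset[of r s] unfolding l_def set_s by blast
  have compat: "r \<le> bump v y \<longleftrightarrow> r \<le> y" if "r \<le> v" for v y using that by (auto simp: bump_def)
  have compat': "Suc r \<le> bump v y \<longleftrightarrow> r \<le> y" if "v \<le> r" for v y using that by (auto simp: bump_def)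
  show ?top
  proof -
    let ?h = "\<lambda>v. x ^ num_top_leaves r (v # map (bump v) s) * g (state_word r (v # map (bump v) s))"
    have "top_site r s (Suc n)"
      unfolding top_site_def
    proof (intro notI, elim exE conjE)
      fix a b assume "subseq [a, b] s" "Suc n \<le> b"
      thus False using subseq_setD[of "[a, b]" s b] set_s by auto
    qed
    hence "{v. v \<in> {r..Suc n} \<and> top_site r s v} = insert (Suc n) {v. v \<in> set l \<and> r \<le> v}"
      using r unfolding inv(1) set_s by (auto simp: le_Suc_eq)
    moreover have "Suc n \<notin> {v. v \<in> set l \<and> r \<le> v}" using sub[of "Suc n"] by auto
    ultimately have "(\<Sum>v | v \<in> {r..Suc n} \<and> top_site r s v. ?h v) =
        ?h (Suc n) + (\<Sum>v | v \<in> set l \<and> r \<le> v. ?h v)" by simp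
    also have "?h (Suc n) = x ^ num_top_leaves r s * (x * g (True # state_word r s))"
    proof -
      have id: "map (bump (Suc n)) s = s" by (rule map_idI) (auto simp: set_s bump_def)
      have "chop (Suc n) l = l" using sub by (intro chop_all) fastforce
      hence "state_word r (Suc n # s) = True # state_word r s" using r by (simp add: state_word_def l_def)
      moreover have "num_top_leaves r (Suc n # s) = Suc (num_top_leaves r s)" using r set_s by auto
      ultimately show ?thesis unfolding id by simp
    qed
    also have "(\<Sum>v | v \<in> set l \<and> r \<le> v. ?h v) =
        (\<Sum>v | v \<in> set l \<and> r \<le> v. x ^ num_top_leaves r s * g (map (\<lambda>y. r \<le> y) (dropWhile (\<lambda>y. y \<noteq> v) l)))"
    proof (intro sum.cong refl)
      fix v assume "v \<in> {v. v \<in> set l \<and> r \<le> v}"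
      hence v: "v \<in> set l" "r \<le> v" by auto
      then obtain p q where pq: "l = p @ v # q" by (meson split_list)
      have vp: "v \<notin> set p" using dl unfolding pq by auto
      have q: "y < v" if "y \<in> set q" for y
      proof (cases "r \<le> y")
        case True
        have "live_order r s v y" using inv(2) that unfolding pq by (simp add: sorted_wrt_append)
        thus ?thesis using True v unfolding live_order_def by auto
      qed (use v in auto)
      have "bump v y = y" if "y \<in> set q" for y using q[OF that] by (simp add: bump_def)
      hence "map (bump v) q = q" by (rule map_idI)
      hence "chop v (map (bump v) l) = q"
        unfolding pq using q chop_append[of v "bump v v" q "map (bump v) p"] by (simp add: bump_def)
      hence "live_sites r (v # map (bump v) s) = v # q"
        using v live_sites_map[OF strict_mono_bump compat[OF v(2)], of s] by (simp add: l_def)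
      hence "state_word r (v # map (bump v) s) = map (\<lambda>y. r \<le> y) (dropWhile (\<lambda>y. y \<noteq> v) l)"
        unfolding state_word_def pq using vp by (simp add: dropWhile_append1 dropWhile_append)
      moreover have "num_top_leaves r (v # map (bump v) s) = num_top_leaves r s"
      proof -
        have "n \<in> set s" "v \<le> n" "1 \<le> n" using sub[OF v(1)] set_s by auto
        hence "bump v n \<in> set (map (bump v) s)" "\<not> bump v n \<le> v" by (auto simp: bump_def)
        hence "\<not> (\<forall>y\<in>set (map (bump v) s). y \<le> v)" by blast
        thus ?thesis using num_top_leaves_map[OF strict_mono_bump compat[OF v(2)], of s] by simp
      qed
      ultimately show "?h v = x ^ num_top_leaves r s * g (map (\<lambda>y. r \<le> y) (dropWhile (\<lambda>y. y \<noteq> v) l))" by simp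
    qed
    also have "\<dots> = x ^ num_top_leaves r s * sum_list (map g (top_suffixes (state_word r s)))"
      unfolding sum_distrib_left[symmetric] sum_top_suffixes[OF dl] by (simp add: state_word_def l_def)
    finally show ?thesis by (simp add: distrib_left)
  qed
  show ?bottom
  proof -
    let ?h = "\<lambda>v. x ^ num_top_leaves (Suc r) (v # map (bump v) s) * g (state_word (Suc r) (v # map (bump v) s))"
    have "bottom_site r s r" unfolding bottom_site_def by auto
    hence eq: "{v. v \<in> {1..r} \<and> bottom_site r s v} = insert r {v \<in> set l. v < r}"
      using r unfolding inv(1) set_s by auto
    have "?h v = x ^ num_top_leaves r s * (\<lambda>t. g (False # t)) (map (\<lambda>y. r \<le> y) (filter (\<lambda>y. v \<le> y) l))"
      if "v \<in> insert r {v \<in> set l. v < r}" for v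
    proof -
      have v: "v \<le> r" using that by auto
      have "v < bump v y \<longleftrightarrow> v \<le> y" for y by (auto simp: bump_def)
      hence "live_sites (Suc r) (v # map (bump v) s) = v # map (bump v) (filter (\<lambda>y. v \<le> y) l)"
        using v by (simp add: live_sites_map[OF strict_mono_bump compat'[OF v]] filter_map o_def l_def)
      hence "state_word (Suc r) (v # map (bump v) s) = False # map (\<lambda>y. r \<le> y) (filter (\<lambda>y. v \<le> y) l)"
        unfolding state_word_def using v by (simp add: compat'[OF v])
      moreover have "num_top_leaves (Suc r) (v # map (bump v) s) = num_top_leaves r s"
        using v by (simp add: num_top_leaves_map[OF strict_mono_bump compat'[OF v]])
      ultimately show ?thesis by simp
    qed
    hence "(\<Sum>v | v \<in> {1..r} \<and> bottom_site r s v. ?h v) =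
      x ^ num_top_leaves r s * (\<Sum>v\<in>insert r {v \<in> set l. v < r}. (\<lambda>t. g (False # t)) (map (\<lambda>y. r \<le> y) (filter (\<lambda>y. v \<le> y) l)))"
      unfolding eq sum_distrib_left by (intro sum.cong refl)
    also have "\<dots> = x ^ num_top_leaves r s * sum_list (map (\<lambda>t. g (False # t)) (bottom_deletions (state_word r s)))"
    proof -
      have "sorted_wrt (\<lambda>a b. a < r \<and> b < r \<longrightarrow> a < b) l"
        by (rule sorted_wrt_mono_rel[OF _ inv(2)]) (auto simp: live_order_def)
      from sum_bottom_deletions[OF this, of "\<lambda>t. g (False # t)"] show ?thesis by (simp add: state_word_def l_def)
    qed
    finally show ?thesis .
  qed
qed

lemma sum_list_of_bool_eq: "distinct xs \<Longrightarrow> (\<Sum>u\<leftarrow>xs. of_bool (u = t)) = (of_bool (t \<in> set xs) :: real)"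
  by (induction xs) auto

lemma set_top_suffixes: "set (top_suffixes w) = {True # t | t. suffix (True # t) w}"
  by (induction w rule: top_suffixes.induct) (auto simp: suffix_Cons)

lemma distinct_top_suffixes: "distinct (top_suffixes w)"
  by (induction w rule: top_suffixes.induct) (auto simp: set_top_suffixes dest: suffix_length_le)

lemma distinct_bottom_deletions: "distinct (bottom_deletions w)"
  by (induction w rule: bottom_deletions.induct) (auto simp: distinct_map dest: length_bottom_deletions)

lemma step_weight_eq_children:
  "x * of_bool (True # w = w') + (\<Sum>t\<leftarrow>top_suffixes w. of_bool (t = w')) + (\<Sum>t\<leftarrow>bottom_deletions w. of_bool (False # t = w'))
    = step_weight x w w'"
proof -
  have T: "(\<Sum>t\<leftarrow>top_suffixes w. of_bool (t = w')) = (of_bool (w' \<in> set (top_suffixes w)) :: real)"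
    by (rule sum_list_of_bool_eq[OF distinct_top_suffixes])
  show ?thesis
  proof (cases w')
    case (Cons a t)
    show ?thesis unfolding T using sum_list_of_bool_eq[OF distinct_bottom_deletions, of t w] Cons
      by (cases a) (auto simp: set_top_suffixes)
  qed (use T in \<open>auto simp: set_top_suffixes\<close>)
qed

lemma length_state_word_le:
  assumes "(s, r) \<in> dominoes n"
  shows "length (state_word r s) \<le> n"
proof -
  have "length s = n"
    using assms by (auto simp: dominoes_altdef dest: length_finite_permutations_of_set)
  thus ?thesis using length_live_sites[of r s] by (simp add: state_word_def)
qed

lemma walk_weight_eq_sum_dominoes:
  "walk_weight x n w' = (\<Sum>(s, r)\<in>dominoes n. x ^ num_top_leaves r s * of_bool (state_word r s = w'))"
proof (induction n arbitrary: w')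
  case 0
  have "dominoes 0 = {([], 1)}" by (auto simp: dominoes_altdef)
  thus ?case by (auto simp: state_word_def)
next
  case (Suc n)
  have "walk_weight x (Suc n) w' = (\<Sum>w | length w \<le> n. \<Sum>(s, r)\<in>dominoes n.
      x ^ num_top_leaves r s * of_bool (state_word r s = w) * step_weight x w w')"
    by (simp add: Suc.IH sum_distrib_right case_prod_unfold)
  also have "\<dots> = (\<Sum>(s, r)\<in>dominoes n. \<Sum>w | length w \<le> n.
      x ^ num_top_leaves r s * of_bool (state_word r s = w) * step_weight x w w')"
    unfolding case_prod_unfold by (rule sum.swap)
  also have "\<dots> = (\<Sum>(s, r)\<in>dominoes n. x ^ num_top_leaves r s * step_weight x (state_word r s) w')"
  proof (intro sum.cong refl, clarify)
    fix s r assume d: "(s, r) \<in> dominoes n"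
    have "(\<Sum>w | length w \<le> n. x ^ num_top_leaves r s * of_bool (state_word r s = w) * step_weight x w w') =
      (\<Sum>w\<in>{state_word r s}. x ^ num_top_leaves r s * of_bool (state_word r s = w) * step_weight x w w')"
      using length_state_word_le[OF d] by (intro sum.mono_neutral_right) auto
    thus "(\<Sum>w | length w \<le> n. x ^ num_top_leaves r s * of_bool (state_word r s = w) * step_weight x w w') =
      x ^ num_top_leaves r s * step_weight x (state_word r s) w'" by simp
  qed
  also have "\<dots> = (\<Sum>(s, r)\<in>dominoes (Suc n). x ^ num_top_leaves r s * of_bool (state_word r s = w'))"
    unfolding sum_dominoes_Suc
  proof (intro sum.cong refl, clarify)
    fix s r assume d: "(s, r) \<in> dominoes n"
    show "x ^ num_top_leaves r s * step_weight x (state_word r s) w' =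
      (\<Sum>v | v \<in> {r..Suc n} \<and> top_site r s v. x ^ num_top_leaves r (v # map (bump v) s) * of_bool (state_word r (v # map (bump v) s) = w')) +
      (\<Sum>v | v \<in> {1..r} \<and> bottom_site r s v. x ^ num_top_leaves (Suc r) (v # map (bump v) s) * of_bool (state_word (Suc r) (v # map (bump v) s) = w'))"
      unfolding sum_children[OF d, where g = "\<lambda>w. of_bool (w = w')"] step_weight_eq_children[symmetric]
      by (simp only: distrib_left add.assoc)
  qed
  finally show ?case .
qed

lemma walk_gf_eq_sum_dominoes: "fps_nth (walk_gf x) n = (\<Sum>d\<in>dominoes n. x ^ card (top_leaves d))"
proof -
  have "fps_nth (walk_gf x) n = (\<Sum>(s, r)\<in>dominoes n. \<Sum>w | length w \<le> n. x ^ num_top_leaves r s * of_bool (state_word r s = w))"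
    unfolding walk_gf_def walk_weight_eq_sum_dominoes case_prod_unfold fps_nth_Abs_fps by (rule sum.swap)
  also have "\<dots> = (\<Sum>(s, r)\<in>dominoes n. x ^ num_top_leaves r s)"
  proof (intro sum.cong refl, clarify)
    fix s r assume d: "(s, r) \<in> dominoes n"
    have "(\<Sum>w | length w \<le> n. x ^ num_top_leaves r s * of_bool (state_word r s = w)) =
      (\<Sum>w\<in>{state_word r s}. x ^ num_top_leaves r s * of_bool (state_word r s = w))"
      using length_state_word_le[OF d] by (intro sum.mono_neutral_right) auto
    thus "(\<Sum>w | length w \<le> n. x ^ num_top_leaves r s * of_bool (state_word r s = w)) = x ^ num_top_leaves r s" by simp
  qed
  finally show ?thesis by (simp add: case_prod_unfold flip: card_top_leaves)
qed

section \<open>Concentration of the number of leaves\<close>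

text \<open>Markov's inequality for the tilted count: on the event, \<open>x\<close> to the number of leaves is at least
  \<open>x\<close> to \<open>t n\<close>, where \<open>x = 1 + d\<close>.\<close>

lemma tilted_tail:
  fixes t d :: real
  assumes lim: "(\<lambda>n. fps_nth (walk_gf (1 + d)) n / ((1 + d) powr t) ^ n / fps_nth (walk_gf 1) n) \<longlonglongrightarrow> 0"
    and d: "1 + d > 0"
    and P: "\<And>n a. n > 0 \<Longrightarrow> P n a \<Longrightarrow> (1 + d) powr (t * real n) \<le> (1 + d) powr (real (card (top_leaves a)))"
  shows "(\<lambda>n. measure_pmf.prob (random_domino n) {a. P n a}) \<longlonglongrightarrow> 0"
proof (rule tendsto_sandwich[OF _ _ tendsto_const lim])
  show "\<forall>\<^sub>F n in sequentially. 0 \<le> measure_pmf.prob (random_domino n) {a. P n a}" by simp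
  show "\<forall>\<^sub>F n in sequentially. measure_pmf.prob (random_domino n) {a. P n a}
      \<le> fps_nth (walk_gf (1 + d)) n / ((1 + d) powr t) ^ n / fps_nth (walk_gf 1) n"
    using eventually_gt_at_top[of 0]
  proof eventually_elim
    case (elim n)
    have "real (card (dominoes n \<inter> {a. P n a})) * (1 + d) powr (t * real n)
        = (\<Sum>a\<in>dominoes n \<inter> {a. P n a}. (1 + d) powr (t * real n))" by simp
    also have "\<dots> \<le> (\<Sum>a\<in>dominoes n \<inter> {a. P n a}. (1 + d) ^ card (top_leaves a))"
      using P[OF elim] d by (intro sum_mono) (simp add: powr_realpow)
    also have "\<dots> \<le> (\<Sum>a\<in>dominoes n. (1 + d) ^ card (top_leaves a))"
      using d finite_dominoes by (intro sum_mono2) auto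
    also have "\<dots> = fps_nth (walk_gf (1 + d)) n" by (simp add: walk_gf_eq_sum_dominoes)
    also have "(1 + d) powr (t * real n) = ((1 + d) powr t) ^ n"
      using d by (simp add: powr_powr powr_realpow[symmetric])
    finally have "real (card (dominoes n \<inter> {a. P n a})) \<le> fps_nth (walk_gf (1 + d)) n / ((1 + d) powr t) ^ n"
      using d by (simp add: pos_le_divide_eq)
    moreover have "measure_pmf.prob (random_domino n) {a. P n a}
        = real (card (dominoes n \<inter> {a. P n a})) / fps_nth (walk_gf 1) n"
      unfolding random_domino_def
      by (simp add: measure_pmf_of_set dominoes_nonempty finite_dominoes walk_gf_eq_sum_dominoes)
    moreover have "fps_nth (walk_gf 1) n \<ge> 0" by (simp add: walk_gf_eq_sum_dominoes)
    ultimately show ?case by (simp only: divide_right_mono)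
  qed
qed

text \<open>The logarithm of the product vanishes at \<open>d = 0\<close> and has derivative \<open>a s + b\<close> there.\<close>

lemma exists_tilt:
  fixes a b s :: real
  assumes "a * s + b > 0"
  shows "\<exists>d. 0 < d \<and> d < 1 \<and> (1 + b * d) * (1 + s * d) powr a > 1"
proof -
  define f where "f d = a * ln (1 + s * d) + ln (1 + b * d)" for d
  have "(f has_real_derivative (a * s + b)) (at 0)"
    unfolding f_def by (auto intro!: derivative_eq_intros)
  then obtain e where e: "e > 0" "\<And>h. 0 < h \<Longrightarrow> h < e \<Longrightarrow> f 0 < f (0 + h)"
    using DERIV_pos_inc_right[of f "a * s + b" 0] assms by auto
  define d where "d = min (e / 2) (1 / (2 * (1 + \<bar>s\<bar> + \<bar>b\<bar>)))"
  have d0: "d > 0" "d < e" using e(1) by (auto simp: d_def min_def)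
  have "d \<le> 1 / (2 * (1 + \<bar>s\<bar> + \<bar>b\<bar>))" by (simp add: d_def)
  hence dd: "d * (1 + \<bar>s\<bar> + \<bar>b\<bar>) \<le> 1 / 2" by (simp add: field_simps)
  have sb: "\<bar>s * d\<bar> \<le> 1 / 2" "\<bar>b * d\<bar> \<le> 1 / 2" "d < 1"
  proof -
    have "d + d * \<bar>s\<bar> + d * \<bar>b\<bar> \<le> 1 / 2" using dd by (simp add: algebra_simps)
    moreover have "d * \<bar>s\<bar> \<ge> 0" "d * \<bar>b\<bar> \<ge> 0" using d0 by auto
    ultimately have "d * \<bar>s\<bar> \<le> 1 / 2" "d * \<bar>b\<bar> \<le> 1 / 2" "d < 1" using d0 by linarith+
    thus "\<bar>s * d\<bar> \<le> 1 / 2" "\<bar>b * d\<bar> \<le> 1 / 2" "d < 1" using d0 by (simp_all add: abs_mult mult.commute)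
  qed
  have p: "1 + s * d > 0" "1 + b * d > 0" using sb by (auto simp: abs_le_iff)
  have "0 < f d" using e(2)[OF d0] by (simp add: f_def)
  hence "1 < exp (f d)" by simp
  also have "exp (f d) = (1 + b * d) * (1 + s * d) powr a"
    using p by (simp add: f_def exp_add powr_def)
  finally show ?thesis using d0 sb by blast
qed

text \<open>The upper tail is treated with \<open>x = 1 + d\<close> and the lower tail with \<open>x = 1 - d\<close>, for a small
  \<open>d > 0\<close>. In both cases the first order gain \<open>\<epsilon> d\<close> beats the slack \<open>\<eta> d\<close> in the bound for the growth
  rate.\<close>

lemma leaf_proportion_concentrated:
  assumes \<epsilon>: "\<epsilon> > 0"
  shows "(\<lambda>n. measure_pmf.prob (random_domino n) {a. \<bar>leaf_proportion n a - 5 / 18\<bar> > \<epsilon>}) \<longlonglongrightarrow> 0"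
proof -
  define \<eta> where "\<eta> = min (\<epsilon> / 2) (1 / 4)"
  have \<eta>: "0 < \<eta>" "\<eta> \<le> 1 / 4" "\<eta> < \<epsilon>" using \<epsilon> by (auto simp: \<eta>_def)
  have upper: "(\<lambda>n. measure_pmf.prob (random_domino n) {a. leaf_proportion n a > 5 / 18 + \<epsilon>}) \<longlonglongrightarrow> 0"
  proof -
    obtain d where d: "0 < d" "d < 1" "(1 + (- (5 / 18) - \<eta>) * d) * (1 + 1 * d) powr (5 / 18 + \<epsilon>) > 1"
      using exists_tilt[of "5 / 18 + \<epsilon>" 1 "- (5 / 18) - \<eta>"] \<eta> by auto
    show ?thesis
    proof (rule tilted_tail[where d = d and t = "5 / 18 + \<epsilon>"])
      show "(\<lambda>n. fps_nth (walk_gf (1 + d)) n / ((1 + d) powr (5 / 18 + \<epsilon>)) ^ n / fps_nth (walk_gf 1) n) \<longlonglongrightarrow> 0"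
        using d \<eta> by (intro near_critical_ratio[of \<eta>]) (auto simp: algebra_simps)
      fix n a assume n: "n > (0 :: nat)" and "leaf_proportion n a > 5 / 18 + \<epsilon>"
      hence "(5 / 18 + \<epsilon>) * real n \<le> real (card (top_leaves a))"
        by (simp add: leaf_proportion_def pos_less_divide_eq)
      thus "(1 + d) powr ((5 / 18 + \<epsilon>) * real n) \<le> (1 + d) powr real (card (top_leaves a))"
        using d by (intro powr_mono) auto
    qed (use d in auto)
  qed
  have lower: "(\<lambda>n. measure_pmf.prob (random_domino n) {a. leaf_proportion n a < 5 / 18 - \<epsilon>}) \<longlonglongrightarrow> 0"
  proof -
    obtain d where d: "0 < d" "d < 1" "(1 + (5 / 18 - \<eta>) * d) * (1 + (- 1) * d) powr (5 / 18 - \<epsilon>) > 1"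
      using exists_tilt[of "5 / 18 - \<epsilon>" "- 1" "5 / 18 - \<eta>"] \<eta> by auto
    show ?thesis
    proof (rule tilted_tail[where d = "- d" and t = "5 / 18 - \<epsilon>"])
      show "(\<lambda>n. fps_nth (walk_gf (1 + - d)) n / ((1 + - d) powr (5 / 18 - \<epsilon>)) ^ n / fps_nth (walk_gf 1) n) \<longlonglongrightarrow> 0"
        using d \<eta> by (intro near_critical_ratio[of \<eta>]) (auto simp: algebra_simps)
      fix n a assume n: "n > (0 :: nat)" and "leaf_proportion n a < 5 / 18 - \<epsilon>"
      hence "real (card (top_leaves a)) \<le> (5 / 18 - \<epsilon>) * real n"
        by (simp add: leaf_proportion_def pos_divide_less_eq)
      thus "(1 + - d) powr ((5 / 18 - \<epsilon>) * real n) \<le> (1 + - d) powr real (card (top_leaves a))"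
        using d by (intro powr_mono') auto
    qed (use d in auto)
  qed
  have "(\<lambda>n. measure_pmf.prob (random_domino n) {a. leaf_proportion n a > 5 / 18 + \<epsilon>} +
      measure_pmf.prob (random_domino n) {a. leaf_proportion n a < 5 / 18 - \<epsilon>}) \<longlonglongrightarrow> 0"
    using tendsto_add[OF upper lower] by simp
  thus ?thesis
  proof (rule tendsto_sandwich[OF _ _ tendsto_const, rotated 2])
    have "{a. \<bar>leaf_proportion n a - 5 / 18\<bar> > \<epsilon>} =
      {a. leaf_proportion n a > 5 / 18 + \<epsilon>} \<union> {a. leaf_proportion n a < 5 / 18 - \<epsilon>}" for n
      by (auto simp: abs_if split: if_splits)
    thus "\<forall>\<^sub>F n in sequentially. measure_pmf.prob (random_domino n) {a. \<bar>leaf_proportion n a - 5 / 18\<bar> > \<epsilon>} \<le>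
      measure_pmf.prob (random_domino n) {a. leaf_proportion n a > 5 / 18 + \<epsilon>} +
      measure_pmf.prob (random_domino n) {a. leaf_proportion n a < 5 / 18 - \<epsilon>}"
      by (simp add: measure_Un_le)
  qed simp
qed

lemma leaf_proportion_bounds:
  assumes "a \<in> dominoes n"
  shows "0 \<le> leaf_proportion n a" "leaf_proportion n a \<le> 1"
proof -
  have "length (fst a) = n"
    using assms by (auto simp: dominoes_def dest: length_finite_permutations_of_set)
  moreover have "card (top_leaves a) \<le> card {..<length (fst a)}"
    unfolding top_leaves_def by (intro card_mono) auto
  ultimately show "0 \<le> leaf_proportion n a" "leaf_proportion n a \<le> 1"
    by (auto simp: leaf_proportion_def divide_le_eq_1)
qed

lemma expectation_close:
  fixes p :: "'a pmf" and f :: "'a \<Rightarrow> real"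
  assumes fin: "finite (set_pmf p)" and f: "\<And>a. a \<in> set_pmf p \<Longrightarrow> \<bar>f a - m\<bar> \<le> 1" and e: "e \<ge> 0"
  shows "\<bar>measure_pmf.expectation p f - m\<bar> \<le> e + measure_pmf.prob p {a. \<bar>f a - m\<bar> > e}"
proof -
  have int: "integrable (measure_pmf p) g" for g :: "'a \<Rightarrow> real"
    using fin by (rule integrable_measure_pmf_finite)
  have "measure_pmf.expectation p f - m = measure_pmf.expectation p (\<lambda>a. f a - m)"
    using int by (simp add: measure_pmf.prob_space)
  also have "\<bar>\<dots>\<bar> \<le> measure_pmf.expectation p (\<lambda>a. \<bar>f a - m\<bar>)"
    by (rule integral_abs_bound)
  also have "\<dots> \<le> measure_pmf.expectation p (\<lambda>a. e + indicator {a. \<bar>f a - m\<bar> > e} a)"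
    using f e by (intro integral_mono_AE int) (auto simp: AE_measure_pmf_iff indicator_def intro!: add_increasing)
  also have "\<dots> = e + measure_pmf.prob p {a. \<bar>f a - m\<bar> > e}"
    using int by (simp add: measure_pmf.prob_space)
  finally show ?thesis .
qed

theorem proposition6p2:
  fixes \<epsilon> :: real
  assumes "\<epsilon> > 0"
  shows "\<forall>\<^sub>F n in sequentially.
    measure_pmf.prob (random_domino n)
      {d. \<bar>leaf_proportion n d - measure_pmf.expectation (random_domino n) (leaf_proportion n)\<bar> \<le> \<epsilon>}
    > 1 - \<epsilon>"
proof -
  define \<delta> where "\<delta> = \<epsilon> / 3"
  have \<delta>: "\<delta> > 0" using assms by (simp add: \<delta>_def)
  let ?bad = "\<lambda>n. measure_pmf.prob (random_domino n) {a. \<bar>leaf_proportion n a - 5 / 18\<bar> > \<delta>}"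
  have "\<forall>\<^sub>F n in sequentially. ?bad n < \<delta>"
    using leaf_proportion_concentrated[OF \<delta>] \<delta> by (rule order_tendstoD)
  thus ?thesis
  proof eventually_elim
    case (elim n)
    let ?m = "measure_pmf.expectation (random_domino n) (leaf_proportion n)"
    have set: "set_pmf (random_domino n) = dominoes n"
      by (simp add: random_domino_def dominoes_nonempty finite_dominoes)
    have "\<bar>leaf_proportion n a - 5 / 18\<bar> \<le> 1" if "a \<in> set_pmf (random_domino n)" for a
      using leaf_proportion_bounds[of a n] that set by (auto simp: abs_le_iff)
    hence "\<bar>?m - 5 / 18\<bar> \<le> \<delta> + ?bad n"
      using \<delta> set finite_dominoes by (intro expectation_close) auto
    hence m: "\<bar>?m - 5 / 18\<bar> < 2 * \<delta>" using elim by simp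
    have "1 - \<epsilon> < 1 - ?bad n" using elim assms by (simp add: \<delta>_def)
    also have "\<dots> = measure_pmf.prob (random_domino n) (- {a. \<bar>leaf_proportion n a - 5 / 18\<bar> > \<delta>})"
      using measure_pmf.prob_compl[of "{a. \<bar>leaf_proportion n a - 5 / 18\<bar> > \<delta>}" "random_domino n"]
      by (simp add: Compl_eq_Diff_UNIV)
    also have "\<dots> \<le> measure_pmf.prob (random_domino n) {d. \<bar>leaf_proportion n d - ?m\<bar> \<le> \<epsilon>}"
    proof (intro measure_pmf.finite_measure_mono subsetI)
      fix a assume "a \<in> - {a. \<bar>leaf_proportion n a - 5 / 18\<bar> > \<delta>}"
      hence "\<bar>leaf_proportion n a - 5 / 18\<bar> \<le> \<delta>" by simp
      moreover have "3 * \<delta> = \<epsilon>" by (simp add: \<delta>_def)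
      ultimately have "\<bar>leaf_proportion n a - ?m\<bar> \<le> \<epsilon>" using m by linarith
      thus "a \<in> {d. \<bar>leaf_proportion n d - ?m\<bar> \<le> \<epsilon>}" by simp
    qed simp
    finally show ?case .
  qed
qed

end
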